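(* Let $\Omega\subset M$ be a past set. Then for all $u,v\in\mathcal H^{\mathrm f}$ the commutator inner product can be written as $$\langle u|v\rangle^\Omega_\rho=-2i\left(\int_\Omega d\rho(x)\int_{M\setminus\Omega}d\rho(y)-\int_{M\setminus\Omega}d\rho(x)\int_\Omega d\rho(y)\right)\prec\psi^u(x)\,|\,Q(x,y)\,\psi^v(y)\succ_x .$$
   Context: Let $(\mathcal H,\langle\cdot|\cdot\rangle_{\mathcal H})$ be a separable complex Hilbert space (scalar product antilinear in the first argument), $n\in\mathbb N$, $\mathcal F\subset\mathrm L(\mathcal H)$ a smooth finite-dimensional manifold of selfadjoint finite-rank operators having exactly $n$ positive and $n$ negative eigenvalues (counting multiplicities) and a fixed trace, $\rho$ a locally finite regular Borel measure on $\mathcal F$ and $M:=\operatorname{supp}\rho$ (spacetime). For $x,y\in\mathcal F$ let $\lambda^{xy}_1,\dots,\lambda^{xy}_{2n}$ be the eigenvalues of $xy$ (the non-zero ones counted with algebraic multiplicity, filled up with zeros). With fixed $\kappa>0$ set $\mathcal L_\kappa(x,y)=\frac1{4n}\sum_{i,j=1}^{2n}(|\lambda^{xy}_i|-|\lambda^{xy}_j|)^2+\kappa\big(\sum_{j}|\lambda^{xy}_j|\big)^2$. The measure $\rho$ is assumed to be critical (it satisfies the weak Euler-Lagrange equations of the causal variational principle with Lagrangian $\mathcal L_\kappa$). Commutator jets and past sets. Fix a finite-dimensional subspace $\mathcal H^{\mathrm f}\subset\mathcal H$. For every selfadjoint $A\in\mathrm L(\mathcal H)$ with $A(\mathcal H^{\mathrm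 f})\subset\mathcal H^{\mathrm f}$ and $A|_{(\mathcal H^{\mathrm f})^\perp}=0$, let $\mathscr C_A(x):=i[A,x]$, a vector field on $\mathcal F$ ("commutator jet on $\mathcal H^{\mathrm f}$"), and let $D_{1,\mathscr C_A}$, $D_{2,\mathscr C_A}$ denote the directional derivatives along it acting on the first resp. second argument, e.g. $D_{1,\mathscr C_A}\mathcal L_\kappa(x,y)=\frac{d}{d\tau}\mathcal L_\kappa(e^{i\tau A}xe^{-i\tau A},y)|_{\tau=0}$ (assumed to exist). A Borel set $\Omega\subset M$ is surface layer finite if $\int_\Omega d\rho(x)\int_{M\setminus\Omega}d\rho(y)\,|(D_{1,\mathscr C_A}-D_{2,\mathscr C_A})\mathcal L_\kappa(x,y)|<\infty$ for all such $A$. Two surface layer finite sets $\Omega,\Omega'$ are causally equivalent if $\int_Ld\rho(x)\int_Ld\rho(y)\,|(D_{1,\mathscr C_A}-D_{2,\mathscr C_A})\mathcal L_\kappa(x,y)|<\infty$ for all such $A$, where $L=(\Omega\setminus\Omega')\cup(\Omega'\setminus\Omega)$. The system is assumed to be time-oriented: there are precisely four equivalence classes $[\varnothing],[M],[\Omega_0],[M\setminus\Omega_0]$ and one class $[\Omega_0]$ has been distinguished; past sets are the elements of $[\Omega_0]$. Commutator inner product. For surface layer finite $\Omega$ set $\gamma^\Omega_\rho(\mathscr C):=\int_\Omega d\rho(x)\int_{M\setminus\Omega}d\rho(y)\,(D_{1,\mathscr C}-D_{2,\mathscr C})\mathcal L_\kappa(x,y)$. For $u\in\mathcal H^{\mathrm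 f}$ let $\mathscr C(u):=\mathscr C_A$ with $A\psi=\langle u|\psi\rangle_{\mathcal H}\,u$. The commutator inner product is $$\langle u|v\rangle^\Omega_\rho:=\tfrac14\big(\gamma^\Omega_\rho(\mathscr C(u+v))-\gamma^\Omega_\rho(\mathscr C(u-v))\big)-\tfrac i4\big(\gamma^\Omega_\rho(\mathscr C(u+iv))-\gamma^\Omega_\rho(\mathscr C(u-iv))\big).$$ Wave functions and the kernel $Q$. For $x\in M$, the spin space is $S_x:=x(\mathcal H)$ with (indefinite) spin inner product $\prec u|v\succ_x=-\langle u|xv\rangle_{\mathcal H}$; $\pi_x:\mathcal H\to S_x$ is the orthogonal projection, $\psi^u(x):=\pi_xu$ is the physical wave function of $u$, and $\Psi(x):\mathcal H\to S_x$, $\Psi(x)u=\psi^u(x)$. One has $x=-\Psi(x)^*\Psi(x)$ (adjoints with respect to the spin inner products). The kernel of the fermionic projector is $P(x,y)=-\Psi(x)\Psi(y)^*:S_y\to S_x$. The Lagrangian $\mathcal L_\kappa(x,y)$ can be expressed in terms of $P(x,y)$ (because $xy$ has the same non-zero eigenvalues as $P(x,y)P(y,x)$), and its first variation is written as $\delta\mathcal L_\kappa(x,y)=2\,\mathrm{Re}\,\mathrm{Tr}_{S_x}\big(Q(x,y)\,\delta P(x,y)^*\big)$ with a kernel $Q(x,y):S_y\to S_x$ which is symmetric, $Q(x,y)^*=Q(y,x)$. This defines $Q$. Under a unitary variation with $x\mapsto e^{i\tau A}xe^{-i\tau A}$, $\Psi(x)$ is varied to $\Psi(x)e^{-i\tau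 A}$. The difference of double integrals in the claim is understood as the integral over $(x,y)\in\Omega\times(M\setminus\Omega)$ of $\prec\psi^u(x)|Q(x,y)\psi^v(y)\succ_x-\prec\psi^u(y)|Q(y,x)\psi^v(x)\succ_y$. *)

theory Defs
  imports "HOL-Analysis.Analysis"
begin

section \<open>Separable complex Hilbert spaces\<close>

text \<open>The library has real inner product spaces only. The inner product is antilinear in its first
  argument; separability is expressed by second countability.\<close>

class complex_hilbert = banach + second_countable_topology +
  fixes scaleC :: "complex \<Rightarrow> 'a \<Rightarrow> 'a"
    and cinner :: "'a \<Rightarrow> 'a \<Rightarrow> complex"
  assumes scaleC_add_right: "scaleC a (x + y) = scaleC a x + scaleC a y"
    and scaleC_add_left: "scaleC (a + b) x = scaleC a x + scaleC b x"
    and scaleC_scaleC: "scaleC a (scaleC b x) = scaleC (a * b) x"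
    and scaleR_scaleC: "scaleR r x = scaleC (complex_of_real r) x"
    and cinner_commute: "cinner x y = cnj (cinner y x)"
    and cinner_add_right: "cinner x (y + z) = cinner x y + cinner x z"
    and cinner_scaleC_right: "cinner x (scaleC a y) = a * cinner x y"
    and cinner_nonneg: "0 \<le> Re (cinner x x)"
    and norm_eq_sqrt_cinner: "norm x = sqrt (Re (cinner x x))"

lemma scaleC_one: "scaleC 1 x = (x :: 'a::complex_hilbert)"
  using scaleR_scaleC[of 1 x] by simp

global_interpretation complex_vector: vector_space "scaleC :: complex \<Rightarrow> 'a \<Rightarrow> 'a::complex_hilbert"
  by unfold_locales (simp_all add: scaleC_add_right scaleC_add_left scaleC_scaleC scaleC_one)

definition cfinite_dim :: "'a::complex_hilbert set \<Rightarrow> bool" where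
  "cfinite_dim S \<longleftrightarrow> (\<exists>B. finite B \<and> S \<subseteq> complex_vector.span B)"

section \<open>Operators\<close>

text \<open>A bounded complex-linear operator is an element of the library type of bounded real-linear maps
  that commutes with complex scalars; the operator norms agree.\<close>

definition clinear_op :: "('a::complex_hilbert \<Rightarrow>\<^sub>L 'a) \<Rightarrow> bool" where
  "clinear_op T \<longleftrightarrow> (\<forall>c v. blinfun_apply T (scaleC c v) = scaleC c (blinfun_apply T v))"

definition selfadjoint :: "('a::complex_hilbert \<Rightarrow>\<^sub>L 'a) \<Rightarrow> bool" where
  "selfadjoint T \<longleftrightarrow> clinear_op T \<and>
     (\<forall>u v. cinner (blinfun_apply T u) v = cinner u (blinfun_apply T v))"

definition finite_rank :: "('a::complex_hilbert \<Rightarrow>\<^sub>L 'a) \<Rightarrow> bool" where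
  "finite_rank T \<longleftrightarrow> cfinite_dim (range (blinfun_apply T))"

definition scaleC_op :: "complex \<Rightarrow> ('a::complex_hilbert \<Rightarrow>\<^sub>L 'a) \<Rightarrow> ('a \<Rightarrow>\<^sub>L 'a)" where
  "scaleC_op c T = Blinfun (\<lambda>v. scaleC c (blinfun_apply T v))"

definition op_exp :: "('a::complex_hilbert \<Rightarrow>\<^sub>L 'a) \<Rightarrow> ('a \<Rightarrow>\<^sub>L 'a)" where
  "op_exp T = (\<Sum>k. (1 / fact k) *\<^sub>R ((\<lambda>B. T o\<^sub>L B) ^^ k) id_blinfun)"

definition unitary_var :: "('a::complex_hilbert \<Rightarrow>\<^sub>L 'a) \<Rightarrow> real \<Rightarrow> ('a \<Rightarrow>\<^sub>L 'a) \<Rightarrow> ('a \<Rightarrow>\<^sub>L 'a)" where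
  "unitary_var A \<tau> x =
     op_exp (scaleC_op (\<i> * of_real \<tau>) A) o\<^sub>L x o\<^sub>L op_exp (scaleC_op (- \<i> * of_real \<tau>) A)"

definition rank_one :: "'a::complex_hilbert \<Rightarrow> ('a \<Rightarrow>\<^sub>L 'a)" where
  "rank_one u = Blinfun (\<lambda>\<psi>. scaleC (cinner u \<psi>) u)"

text \<open>The trace of a linear map of a finite-dimensional subspace \<open>S\<close> to itself, computed in an
  orthonormal basis (the value does not depend on the choice).\<close>

definition onb_of :: "'a::complex_hilbert set \<Rightarrow> 'a set \<Rightarrow> bool" where
  "onb_of S B \<longleftrightarrow> finite B \<and> complex_vector.span B = S \<and>
     (\<forall>e\<in>B. \<forall>f\<in>B. cinner e f = (if e = f then 1 else 0))"

definition trace_on :: "'a::complex_hilbert set \<Rightarrow> ('a \<Rightarrow> 'a) \<Rightarrow> complex" where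
  "trace_on S T = (\<Sum>e\<in>(SOME B. onb_of S B). cinner e (T e))"

text \<open>Dimension of the generalized eigenspace, for a linear map of the subspace \<open>S\<close> to itself.
  It is only used for non-zero eigenvalues of maps of finite rank, where this dimension is finite.\<close>

definition alg_mult :: "'a::complex_hilbert set \<Rightarrow> ('a \<Rightarrow> 'a) \<Rightarrow> complex \<Rightarrow> nat" where
  "alg_mult S T l =
     complex_vector.dim {v \<in> S. \<exists>k. ((\<lambda>w. T w - scaleC l w) ^^ k) v = 0}"

text \<open>The list \<open>\<lambda>\<^sub>1, \<dots>, \<lambda>\<^sub>m\<close> of the non-zero eigenvalues, counted with algebraic multiplicity and
  filled up with zeros. It is unique up to the order of its entries.\<close>

definition eigenvalue_list :: "nat \<Rightarrow> 'a::complex_hilbert set \<Rightarrow> ('a \<Rightarrow> 'a) \<Rightarrow> complex list" where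
  "eigenvalue_list m S T =
     (SOME ls. length ls = m \<and> (\<forall>l. l \<noteq> 0 \<longrightarrow> count_list ls l = alg_mult S T l))"

definition regular_ops :: "nat \<Rightarrow> ('a::complex_hilbert \<Rightarrow>\<^sub>L 'a) set" where
  "regular_ops n = {x. selfadjoint x \<and> finite_rank x \<and>
     (\<Sum>l\<in>{l::real. 0 < l \<and> alg_mult UNIV (blinfun_apply x) (of_real l) \<noteq> 0}.
        alg_mult UNIV (blinfun_apply x) (of_real l)) = n \<and>
     (\<Sum>l\<in>{l::real. l < 0 \<and> alg_mult UNIV (blinfun_apply x) (of_real l) \<noteq> 0}.
        alg_mult UNIV (blinfun_apply x) (of_real l)) = n}"

definition op_trace :: "('a::complex_hilbert \<Rightarrow>\<^sub>L 'a) \<Rightarrow> complex" where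
  "op_trace x = trace_on (range (blinfun_apply x)) (blinfun_apply x)"

section \<open>Embedded smooth finite-dimensional submanifolds of normed spaces\<close>

text \<open>\<open>m\<close> times continuously differentiable functions on an open subset \<open>V\<close> of \<open>\<real>\<^sup>k\<close> (in the sense of
  \<^const>\<open>Euclidean_space\<close>), in terms of partial derivatives.\<close>

primrec Cm_on :: "nat \<Rightarrow> nat \<Rightarrow> (nat \<Rightarrow> real) set \<Rightarrow> ((nat \<Rightarrow> real) \<Rightarrow> 'b::real_normed_vector) \<Rightarrow> bool"
  where
  "Cm_on k 0 V f \<longleftrightarrow> continuous_on V f"
| "Cm_on k (Suc m) V f \<longleftrightarrow> continuous_on V f \<and>
     (\<exists>f'. \<forall>i<k. Cm_on k m V (f' i) \<and>
        (\<forall>c\<in>V. ((\<lambda>t. f (c(i := t))) has_vector_derivative f' i c) (at (c i))))"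

definition immersion_on :: "nat \<Rightarrow> (nat \<Rightarrow> real) set \<Rightarrow> ((nat \<Rightarrow> real) \<Rightarrow> 'b::real_normed_vector) \<Rightarrow> bool"
  where
  "immersion_on k V f \<longleftrightarrow> (\<forall>c\<in>V. \<forall>a::nat \<Rightarrow> real.
     (\<Sum>i<k. a i *\<^sub>R vector_derivative (\<lambda>t. f (c(i := t))) (at (c i))) = 0 \<longrightarrow> (\<forall>i<k. a i = 0))"

definition smooth_submanifold :: "nat \<Rightarrow> 'b::real_normed_vector set \<Rightarrow> bool" where
  "smooth_submanifold k F \<longleftrightarrow> second_countable (top_of_set F) \<and>
     (\<forall>x\<in>F. \<exists>U V \<phi>. openin (top_of_set F) U \<and> x \<in> U \<and> openin (Euclidean_space k) V \<and>
        homeomorphic_map (subtopology (Euclidean_space k) V) (top_of_set U) \<phi> \<and>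
        (\<forall>m. Cm_on k m V \<phi>) \<and> immersion_on k V \<phi>)"

definition smooth_curve :: "'b::real_normed_vector set \<Rightarrow> (real \<Rightarrow> 'b) \<Rightarrow> bool" where
  "smooth_curve F c \<longleftrightarrow> (\<exists>\<epsilon>>0. \<exists>D. D 0 = c \<and> (\<forall>t\<in>{-\<epsilon><..<\<epsilon>}. c t \<in> F \<and>
     (\<forall>k::nat. (D k has_vector_derivative D (Suc k) t) (at t))))"

definition tangent_space :: "'b::real_normed_vector set \<Rightarrow> 'b \<Rightarrow> 'b set" where
  "tangent_space F x =
     {v. \<exists>c. smooth_curve F c \<and> c 0 = x \<and> (c has_vector_derivative v) (at 0)}"

section \<open>The measure and its support\<close>

definition locally_finite_regular :: "'b::topological_space set \<Rightarrow> 'b measure \<Rightarrow> bool" where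
  "locally_finite_regular F \<rho> \<longleftrightarrow> sets \<rho> = sets (restrict_space borel F) \<and>
     (\<forall>x\<in>F. \<exists>U. openin (top_of_set F) U \<and> x \<in> U \<and> emeasure \<rho> U < \<infinity>) \<and>
     (\<forall>B\<in>sets \<rho>.
        emeasure \<rho> B = (INF U\<in>{U. openin (top_of_set F) U \<and> B \<subseteq> U}. emeasure \<rho> U) \<and>
        emeasure \<rho> B = (SUP K\<in>{K. compact K \<and> K \<subseteq> B}. emeasure \<rho> K))"

definition supp :: "'b::topological_space measure \<Rightarrow> 'b set" where
  "supp \<rho> = {x \<in> space \<rho>. \<forall>U. open U \<and> x \<in> U \<longrightarrow> 0 < emeasure \<rho> (U \<inter> space \<rho>)}"

section \<open>The Lagrangian and the weak Euler-Lagrange equations\<close>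

definition lagrangian_of :: "real \<Rightarrow> nat \<Rightarrow> 'a::complex_hilbert set \<Rightarrow> ('a \<Rightarrow> 'a) \<Rightarrow> real" where
  "lagrangian_of \<kappa> n S T = (let l = eigenvalue_list (2 * n) S T in
     1 / (4 * real n) * (\<Sum>i<2*n. \<Sum>j<2*n. (cmod (l ! i) - cmod (l ! j))\<^sup>2)
     + \<kappa> * (\<Sum>j<2*n. cmod (l ! j))\<^sup>2)"

definition lagrangian ::
  "real \<Rightarrow> nat \<Rightarrow> ('a::complex_hilbert \<Rightarrow>\<^sub>L 'a) \<Rightarrow> ('a \<Rightarrow>\<^sub>L 'a) \<Rightarrow> real" where
  "lagrangian \<kappa> n x y = lagrangian_of \<kappa> n UNIV (blinfun_apply (x o\<^sub>L y))"

text \<open>The function \<open>\<ell> + \<s>\<close>, and the weak Euler-Lagrange equations \<open>\<nabla>\<^sub>\<u> \<ell> = 0\<close> on \<open>M\<close>: the scalar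
  components of the jets \<open>\<u>\<close> give \<open>\<ell> = 0\<close> on \<open>M\<close>; their vector components give the vanishing of all
  directional derivatives of \<open>\<ell>\<close> in \<open>F\<close> (as far as they exist) at the points of \<open>M\<close>.\<close>

definition ell_plus ::
  "real \<Rightarrow> nat \<Rightarrow> ('a::complex_hilbert \<Rightarrow>\<^sub>L 'a) measure \<Rightarrow> ('a \<Rightarrow>\<^sub>L 'a) \<Rightarrow> real" where
  "ell_plus \<kappa> n \<rho> x = (LINT y:supp \<rho>|\<rho>. lagrangian \<kappa> n x y)"

definition weak_EL ::
  "real \<Rightarrow> nat \<Rightarrow> ('a::complex_hilbert \<Rightarrow>\<^sub>L 'a) set \<Rightarrow> ('a \<Rightarrow>\<^sub>L 'a) measure \<Rightarrow> bool" where
  "weak_EL \<kappa> n F \<rho> \<longleftrightarrow> (\<exists>\<s>::real. \<forall>x\<in>supp \<rho>.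
     set_integrable \<rho> (supp \<rho>) (lagrangian \<kappa> n x) \<and> ell_plus \<kappa> n \<rho> x - \<s> = 0 \<and>
     (\<forall>c d. smooth_curve F c \<and> c 0 = x \<and>
        (\<forall>\<^sub>F \<tau> in nhds 0. set_integrable \<rho> (supp \<rho>) (lagrangian \<kappa> n (c \<tau>))) \<and>
        ((\<lambda>\<tau>. ell_plus \<kappa> n \<rho> (c \<tau>) - \<s>) has_real_derivative d) (at 0) \<longrightarrow> d = 0))"

section \<open>Commutator jets, surface layer finite sets and past sets\<close>

definition jet_ops :: "'a::complex_hilbert set \<Rightarrow> ('a \<Rightarrow>\<^sub>L 'a) set" where
  "jet_ops Hf = {A. selfadjoint A \<and> blinfun_apply A ` Hf \<subseteq> Hf \<and>
     (\<forall>v. (\<forall>u\<in>Hf. cinner u v = 0) \<longrightarrow> blinfun_apply A v = 0)}"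

definition commutator_jet :: "('a::complex_hilbert \<Rightarrow>\<^sub>L 'a) \<Rightarrow> ('a \<Rightarrow>\<^sub>L 'a) \<Rightarrow> ('a \<Rightarrow>\<^sub>L 'a)" where
  "commutator_jet A x = scaleC_op \<i> ((A o\<^sub>L x) - (x o\<^sub>L A))"

definition D1_lagrangian ::
  "real \<Rightarrow> nat \<Rightarrow> ('a::complex_hilbert \<Rightarrow>\<^sub>L 'a) \<Rightarrow> ('a \<Rightarrow>\<^sub>L 'a) \<Rightarrow> ('a \<Rightarrow>\<^sub>L 'a) \<Rightarrow> real" where
  "D1_lagrangian \<kappa> n A x y = deriv (\<lambda>\<tau>. lagrangian \<kappa> n (unitary_var A \<tau> x) y) 0"

definition D2_lagrangian ::
  "real \<Rightarrow> nat \<Rightarrow> ('a::complex_hilbert \<Rightarrow>\<^sub>L 'a) \<Rightarrow> ('a \<Rightarrow>\<^sub>L 'a) \<Rightarrow> ('a \<Rightarrow>\<^sub>L 'a) \<Rightarrow> real" where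
  "D2_lagrangian \<kappa> n A x y = deriv (\<lambda>\<tau>. lagrangian \<kappa> n x (unitary_var A \<tau> y)) 0"

definition jet_derivatives_exist ::
  "real \<Rightarrow> nat \<Rightarrow> ('a::complex_hilbert \<Rightarrow>\<^sub>L 'a) measure \<Rightarrow> 'a set \<Rightarrow> bool" where
  "jet_derivatives_exist \<kappa> n \<rho> Hf \<longleftrightarrow> (\<forall>A\<in>jet_ops Hf. \<forall>x\<in>supp \<rho>. \<forall>y\<in>supp \<rho>.
     (\<lambda>\<tau>. lagrangian \<kappa> n (unitary_var A \<tau> x) y) differentiable (at 0) \<and>
     (\<lambda>\<tau>. lagrangian \<kappa> n x (unitary_var A \<tau> y)) differentiable (at 0))"

definition surface_density ::
  "real \<Rightarrow> nat \<Rightarrow> ('a::complex_hilbert \<Rightarrow>\<^sub>L 'a) \<Rightarrow> ('a \<Rightarrow>\<^sub>L 'a) \<Rightarrow> ('a \<Rightarrow>\<^sub>L 'a) \<Rightarrow> real" where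
  "surface_density \<kappa> n A x y = D1_lagrangian \<kappa> n A x y - D2_lagrangian \<kappa> n A x y"

text \<open>Finiteness of \<open>\<integral>\<^sub>X d\<rho>(x) \<integral>\<^sub>Y d\<rho>(y) |f(x,y)|\<close>, including the measurability of \<open>f\<close> which is
  implicit in writing this integral.\<close>

definition double_integral_finite ::
  "'b measure \<Rightarrow> 'b set \<Rightarrow> 'b set \<Rightarrow> ('b \<Rightarrow> 'b \<Rightarrow> real) \<Rightarrow> bool" where
  "double_integral_finite \<rho> X Y f \<longleftrightarrow>
     set_borel_measurable (\<rho> \<Otimes>\<^sub>M \<rho>) (X \<times> Y) (\<lambda>(x, y). f x y) \<and>
     (\<integral>\<^sup>+x\<in>X. (\<integral>\<^sup>+y\<in>Y. ennreal \<bar>f x y\<bar> \<partial>\<rho>) \<partial>\<rho>) < \<infinity>"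

definition surface_layer_finite ::
  "real \<Rightarrow> nat \<Rightarrow> ('a::complex_hilbert \<Rightarrow>\<^sub>L 'a) measure \<Rightarrow> 'a set \<Rightarrow> ('a \<Rightarrow>\<^sub>L 'a) set set" where
  "surface_layer_finite \<kappa> n \<rho> Hf = {\<Omega> \<in> sets \<rho>. \<Omega> \<subseteq> supp \<rho> \<and>
     (\<forall>A\<in>jet_ops Hf. double_integral_finite \<rho> \<Omega> (supp \<rho> - \<Omega>) (surface_density \<kappa> n A))}"

text \<open>On the surface layer finite sets this is transitive: for \<open>\<Omega>1 \<sim> \<Omega>2 \<sim> \<Omega>3\<close>, any two points of
  the symmetric difference of \<open>\<Omega>1\<close> and \<open>\<Omega>3\<close> that are not covered by one of the two given
  equivalences are separated by \<open>\<Omega>1\<close> or by \<open>\<Omega>2\<close>.\<close>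

definition causally_equivalent ::
  "real \<Rightarrow> nat \<Rightarrow> ('a::complex_hilbert \<Rightarrow>\<^sub>L 'a) measure \<Rightarrow> 'a set \<Rightarrow> ('a \<Rightarrow>\<^sub>L 'a) set rel" where
  "causally_equivalent \<kappa> n \<rho> Hf =
     {(\<Omega>, \<Omega>'). \<Omega> \<in> surface_layer_finite \<kappa> n \<rho> Hf \<and> \<Omega>' \<in> surface_layer_finite \<kappa> n \<rho> Hf \<and>
        (\<forall>A\<in>jet_ops Hf.
           double_integral_finite \<rho> ((\<Omega> - \<Omega>') \<union> (\<Omega>' - \<Omega>)) ((\<Omega> - \<Omega>') \<union> (\<Omega>' - \<Omega>))
             (surface_density \<kappa> n A))}"

definition time_oriented ::
  "real \<Rightarrow> nat \<Rightarrow> ('a::complex_hilbert \<Rightarrow>\<^sub>L 'a) measure \<Rightarrow> 'a set \<Rightarrow> ('a \<Rightarrow>\<^sub>L 'a) set \<Rightarrow> bool" where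
  "time_oriented \<kappa> n \<rho> Hf \<Omega>0 \<longleftrightarrow>
     (let R = causally_equivalent \<kappa> n \<rho> Hf; S = surface_layer_finite \<kappa> n \<rho> Hf; M = supp \<rho> in
        \<Omega>0 \<in> S \<and> S // R = {R `` {{}}, R `` {M}, R `` {\<Omega>0}, R `` {M - \<Omega>0}} \<and> card (S // R) = 4)"

definition past_sets ::
  "real \<Rightarrow> nat \<Rightarrow> ('a::complex_hilbert \<Rightarrow>\<^sub>L 'a) measure \<Rightarrow> 'a set \<Rightarrow> ('a \<Rightarrow>\<^sub>L 'a) set \<Rightarrow>
     ('a \<Rightarrow>\<^sub>L 'a) set set" where
  "past_sets \<kappa> n \<rho> Hf \<Omega>0 = causally_equivalent \<kappa> n \<rho> Hf `` {\<Omega>0}"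

section \<open>The commutator inner product\<close>

definition surface_layer_integral ::
  "real \<Rightarrow> nat \<Rightarrow> ('a::complex_hilbert \<Rightarrow>\<^sub>L 'a) measure \<Rightarrow> ('a \<Rightarrow>\<^sub>L 'a) set \<Rightarrow> ('a \<Rightarrow>\<^sub>L 'a) \<Rightarrow> real" where
  "surface_layer_integral \<kappa> n \<rho> \<Omega> A =
     (LINT x:\<Omega>|\<rho>. (LINT y:supp \<rho> - \<Omega>|\<rho>. surface_density \<kappa> n A x y))"

definition commutator_inner ::
  "real \<Rightarrow> nat \<Rightarrow> ('a::complex_hilbert \<Rightarrow>\<^sub>L 'a) measure \<Rightarrow> ('a \<Rightarrow>\<^sub>L 'a) set \<Rightarrow> 'a \<Rightarrow> 'a \<Rightarrow> complex" where
  "commutator_inner \<kappa> n \<rho> \<Omega> u v =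
     (let \<gamma> = (\<lambda>w. complex_of_real (surface_layer_integral \<kappa> n \<rho> \<Omega> (rank_one w))) in
        1 / 4 * (\<gamma> (u + v) - \<gamma> (u - v))
        - \<i> / 4 * (\<gamma> (u + scaleC \<i> v) - \<gamma> (u - scaleC \<i> v)))"

section \<open>Wave functions and the kernels \<open>P\<close> and \<open>Q\<close>\<close>

definition spin_space :: "('a::complex_hilbert \<Rightarrow>\<^sub>L 'a) \<Rightarrow> 'a set" where
  "spin_space x = range (blinfun_apply x)"

definition spin_inner :: "('a::complex_hilbert \<Rightarrow>\<^sub>L 'a) \<Rightarrow> 'a \<Rightarrow> 'a \<Rightarrow> complex" where
  "spin_inner x u v = - cinner u (blinfun_apply x v)"

text \<open>\<open>wave x u\<close> is \<open>\<psi>\<^sup>u(x) = \<Psi>(x) u = \<pi>\<^sub>x u\<close>.\<close>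

definition wave :: "('a::complex_hilbert \<Rightarrow>\<^sub>L 'a) \<Rightarrow> 'a \<Rightarrow> 'a" where
  "wave x u = (THE w. w \<in> spin_space x \<and> (\<forall>v\<in>spin_space x. cinner v (u - w) = 0))"

definition wave_adj :: "('a::complex_hilbert \<Rightarrow>\<^sub>L 'a) \<Rightarrow> 'a \<Rightarrow> 'a" where
  "wave_adj x v = (THE w. \<forall>u. spin_inner x (wave x u) v = cinner u w)"

definition kernel_P :: "('a::complex_hilbert \<Rightarrow>\<^sub>L 'a) \<Rightarrow> ('a \<Rightarrow>\<^sub>L 'a) \<Rightarrow> 'a \<Rightarrow> 'a" where
  "kernel_P x y v = - wave x (wave_adj y v)"

text \<open>Linear maps from \<open>S\<^sub>y\<close> to \<open>S\<^sub>x\<close>; the values outside \<open>S\<^sub>y\<close> are irrelevant.\<close>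

definition spin_maps :: "('a::complex_hilbert \<Rightarrow>\<^sub>L 'a) \<Rightarrow> ('a \<Rightarrow>\<^sub>L 'a) \<Rightarrow> ('a \<Rightarrow> 'a) set" where
  "spin_maps x y = {T. T ` spin_space y \<subseteq> spin_space x \<and>
     (\<forall>u\<in>spin_space y. \<forall>v\<in>spin_space y. T (u + v) = T u + T v) \<and>
     (\<forall>c. \<forall>v\<in>spin_space y. T (scaleC c v) = scaleC c (T v))}"

text \<open>The adjoint \<open>S\<^sub>x \<rightarrow> S\<^sub>y\<close>, with respect to the spin inner products, of a map \<open>S\<^sub>y \<rightarrow> S\<^sub>x\<close>.\<close>

definition spin_adj ::
  "('a::complex_hilbert \<Rightarrow>\<^sub>L 'a) \<Rightarrow> ('a \<Rightarrow>\<^sub>L 'a) \<Rightarrow> ('a \<Rightarrow> 'a) \<Rightarrow> 'a \<Rightarrow> 'a" where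
  "spin_adj x y T v =
     (THE w. w \<in> spin_space y \<and> (\<forall>u\<in>spin_space y. spin_inner x (T u) v = spin_inner y u w))"

text \<open>The Lagrangian as a function of a map \<open>p : S\<^sub>y \<rightarrow> S\<^sub>x\<close> in place of \<open>P(x,y)\<close>: it is formed of
  the eigenvalues of \<open>p p\<^sup>*\<close>, where \<open>P(x,y)\<^sup>* = P(y,x)\<close>.\<close>

definition lagrangian_P ::
  "real \<Rightarrow> nat \<Rightarrow> ('a::complex_hilbert \<Rightarrow>\<^sub>L 'a) \<Rightarrow> ('a \<Rightarrow>\<^sub>L 'a) \<Rightarrow> ('a \<Rightarrow> 'a) \<Rightarrow> real" where
  "lagrangian_P \<kappa> n x y p = lagrangian_of \<kappa> n (spin_space x) (p \<circ> spin_adj x y p)"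

text \<open>\<open>Q\<close> is a symmetric kernel which represents the first variation of the Lagrangian. The variations
  are arbitrary families \<open>p \<tau>\<close> of maps \<open>S\<^sub>y \<rightarrow> S\<^sub>x\<close> with \<open>p 0 = P(x,y)\<close> which are differentiable at
  \<open>\<tau> = 0\<close> with derivative \<open>dP\<close>, and along which the first variation \<open>dL\<close> of the Lagrangian exists.\<close>

definition is_kernel_Q ::
  "real \<Rightarrow> nat \<Rightarrow> ('a::complex_hilbert \<Rightarrow>\<^sub>L 'a) measure \<Rightarrow>
     (('a \<Rightarrow>\<^sub>L 'a) \<Rightarrow> ('a \<Rightarrow>\<^sub>L 'a) \<Rightarrow> 'a \<Rightarrow> 'a) \<Rightarrow> bool" where
  "is_kernel_Q \<kappa> n \<rho> Q \<longleftrightarrow> (\<forall>x\<in>supp \<rho>. \<forall>y\<in>supp \<rho>.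
     Q x y \<in> spin_maps x y \<and>
     (\<forall>v\<in>spin_space x. spin_adj x y (Q x y) v = Q y x v) \<and>
     (\<forall>p dP dL.
        (\<forall>\<tau>. p \<tau> \<in> spin_maps x y) \<and> (\<forall>v\<in>spin_space y. p 0 v = kernel_P x y v) \<and>
        (\<forall>v\<in>spin_space y. ((\<lambda>\<tau>. p \<tau> v) has_vector_derivative dP v) (at 0)) \<and>
        ((\<lambda>\<tau>::real. lagrangian_P \<kappa> n x y (p \<tau>)) has_real_derivative dL) (at 0)
        \<longrightarrow> dL = 2 * Re (trace_on (spin_space x) (Q x y \<circ> spin_adj x y dP))))"

end

(* With A the rank-one operator of w, U = exp(i tau A) and V = exp(-i tau A), the Lagrangian at
   (U x V, y) is the Lagrangian of the varied kernel p_tau = pi_x V y : S_y -> S_x. Indeed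
   p_tau p_tau^* = pi_x V y U x on S_x, which x intertwines with x V y U, and U conjugates the latter
   to U x V y. Inserting the derivative of p_tau, a map of rank one, into the variational formula
   defining Q gives D_1 L = 2 Im <psi^w(x)| Q(x,y) psi^w(y)>. Since varying y is conjugate to varying
   x backwards, D_2 L = - D_1 L, and by the symmetry of Q the integrand of the surface layer integral
   is -2i times the diagonal of the sesquilinear form in the claim. Polarization under the integral
   sign and Fubini's theorem finish the proof; Fubini needs sigma-finiteness, which holds because F is
   Lindelof and rho is locally finite. *)
theory Submission
  imports Defs
begin

section \<open>Complex inner products and projections\<close>

abbreviation clinear :: "('a::complex_hilbert \<Rightarrow> 'a) \<Rightarrow> bool" where
  "clinear \<equiv> Vector_Spaces.linear scaleC scaleC"

lemma clinear_iff:
  "clinear f \<longleftrightarrow> (\<forall>x y. f (x + y) = f x + f y) \<and> (\<forall>c x. f (scaleC c x) = scaleC c (f x))"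
  unfolding Vector_Spaces.linear_iff using complex_vector.vector_space_axioms by blast

lemma cinner_add_left: "cinner (x + y) z = cinner x z + cinner y (z::'a::complex_hilbert)"
  by (metis cinner_add_right cinner_commute complex_cnj_add)

lemma cinner_scaleC_left: "cinner (scaleC a x) y = cnj a * cinner x (y::'a::complex_hilbert)"
  by (metis cinner_commute cinner_scaleC_right complex_cnj_mult)

lemma cinner_zero_right [simp]: "cinner x (0::'a::complex_hilbert) = 0"
  using cinner_add_right[of x 0 0] by simp

lemma cinner_zero_left [simp]: "cinner (0::'a::complex_hilbert) x = 0"
  using cinner_add_left[of 0 0 x] by simp

lemma cinner_minus_right [simp]: "cinner x (- y) = - cinner x (y::'a::complex_hilbert)"
  using cinner_add_right[of x y "- y"] by (simp add: add_eq_0_iff)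

lemma cinner_minus_left [simp]: "cinner (- x) y = - cinner x (y::'a::complex_hilbert)"
  using cinner_add_left[of x "- x" y] by (simp add: add_eq_0_iff)

lemma cinner_diff_right: "cinner x (y - z) = cinner x y - cinner x (z::'a::complex_hilbert)"
  using cinner_add_right[of x y "- z"] by simp

lemma cinner_diff_left: "cinner (x - y) z = cinner x z - cinner y (z::'a::complex_hilbert)"
  using cinner_add_left[of x "- y" z] by simp

lemmas cinner_simps = cinner_add_left cinner_add_right cinner_diff_left cinner_diff_right
  cinner_scaleC_left cinner_scaleC_right

lemma cinner_sum_right: "cinner x (\<Sum>i\<in>I. f i) = (\<Sum>i\<in>I. cinner x (f i :: 'a::complex_hilbert))"
  by (induction I rule: infinite_finite_induct) (simp_all add: cinner_add_right)

lemma cinner_self: "cinner x x = complex_of_real ((norm (x::'a::complex_hilbert))\<^sup>2)"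
proof -
  \<comment> \<open>The norm axiom only speaks of the real part; Hermitian symmetry makes the value
    real.\<close>
  have "Im (cinner x x) = 0"
    using cinner_commute[of x x] by (simp add: complex_eq_iff)
  then show ?thesis
    by (simp add: complex_eq_iff norm_eq_sqrt_cinner cinner_nonneg)
qed

lemma cinner_self_eq_0 [simp]: "cinner x x = 0 \<longleftrightarrow> x = (0::'a::complex_hilbert)"
  by (simp add: cinner_self)

lemma norm_scaleC: "norm (scaleC c x) = cmod c * norm (x::'a::complex_hilbert)"
proof -
  have "cinner (scaleC c x) (scaleC c x) = (c * cnj c) * cinner x x"
    by (simp add: cinner_simps mult.assoc mult.left_commute)
  then have "complex_of_real ((norm (scaleC c x))\<^sup>2) = complex_of_real ((cmod c * norm x)\<^sup>2)"
    unfolding cinner_self complex_norm_square[symmetric] by (simp add: power_mult_distrib)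
  then have "(norm (scaleC c x))\<^sup>2 = (cmod c * norm x)\<^sup>2"
    using of_real_eq_iff by blast
  then show ?thesis
    by (simp add: power2_eq_iff_nonneg)
qed

lemma cinner_cauchy_schwarz: "cmod (cinner u v) \<le> norm u * norm (v::'a::complex_hilbert)"
proof (cases "v = 0")
  case False
  \<comment> \<open>Up to the factor \<open>cinner v v\<close>, this is the component of
    \<open>u\<close> orthogonal to \<open>v\<close>; the scaling avoids a division.\<close>
  define w where "w = scaleC (cinner v v) u - scaleC (cinner v u) v"
  have "cinner w w = cinner v v * (cinner v v * cinner u u - cinner u v * cinner v u)"
    unfolding w_def cinner_simps
    by (simp add: cinner_commute[of v u, symmetric] cinner_commute[of u v, symmetric]
        cinner_commute[of v v, symmetric] algebra_simps)
  also have "cinner u v * cinner v u = complex_of_real ((cmod (cinner u v))\<^sup>2)"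
    by (metis cinner_commute complex_norm_square)
  also have "cinner v v * (cinner v v * cinner u u - complex_of_real ((cmod (cinner u v))\<^sup>2))
    = complex_of_real ((norm v)\<^sup>2 * ((norm v)\<^sup>2 * (norm u)\<^sup>2 - (cmod (cinner u v))\<^sup>2))"
    by (simp add: cinner_self)
  finally have "(norm v)\<^sup>2 * ((norm v)\<^sup>2 * (norm u)\<^sup>2 - (cmod (cinner u v))\<^sup>2) \<ge> 0"
    using cinner_nonneg[of w] by simp
  then have "(cmod (cinner u v))\<^sup>2 \<le> (norm u * norm v)\<^sup>2"
    using False by (simp add: zero_le_mult_iff power_mult_distrib mult.commute)
  then show ?thesis
    by (rule power2_le_imp_le) simp
qed simp

lemma bounded_linear_scaleC_left: "bounded_linear (\<lambda>c. scaleC c (x::'a::complex_hilbert))"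
  by (rule bounded_linear_intro[where K = "norm x"])
    (simp_all add: scaleC_add_left scaleR_scaleC scaleC_scaleC norm_scaleC scaleR_conv_of_real)

lemma bounded_linear_scaleC_right: "bounded_linear (scaleC c :: 'a::complex_hilbert \<Rightarrow> 'a)"
  by (rule bounded_linear_intro[where K = "cmod c"])
    (simp_all add: scaleC_add_right scaleR_scaleC scaleC_scaleC norm_scaleC mult.commute)

lemma bounded_linear_cinner_right: "bounded_linear (cinner (u::'a::complex_hilbert))"
  by (rule bounded_linear_intro[where K = "norm u"])
    (simp_all add: cinner_add_right scaleR_scaleC cinner_scaleC_right scaleR_conv_of_real
      cinner_cauchy_schwarz mult.commute[of "norm _" "norm u"])

lemma eq_by_cinner:
  assumes "\<And>z. cinner z x = cinner z (y::'a::complex_hilbert)"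
  shows "x = y"
  using assms[of "x - y"] cinner_self_eq_0[of "x - y"] by (simp add: cinner_diff_right)

section \<open>Orthonormal bases of finite-dimensional subspaces, and traces\<close>

lemma onb_of_orthogonal:
  assumes "onb_of S B" "\<And>e. e \<in> B \<Longrightarrow> cinner e w = 0" "v \<in> S"
  shows "cinner v w = 0"
proof -
  have "v \<in> complex_vector.span B"
    using assms by (simp add: onb_of_def)
  then show ?thesis
    by (induction rule: complex_vector.span_induct_alt) (simp_all add: cinner_simps assms)
qed

lemma onb_of_cinner_sum:
  assumes "onb_of S B" "e \<in> B"
  shows "cinner e (\<Sum>f\<in>B. scaleC (c f) f) = c e"
proof -
  have "cinner e (\<Sum>f\<in>B. scaleC (c f) f) = (\<Sum>f\<in>B. if f = e then c f else 0)"
    unfolding cinner_sum_right cinner_scaleC_right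
    using assms by (intro sum.cong) (auto simp: onb_of_def)
  then show ?thesis
    using assms by (simp add: onb_of_def)
qed

lemma onb_of_sum_in:
  assumes "onb_of S B"
  shows "(\<Sum>f\<in>B. scaleC (c f) f) \<in> S"
proof -
  have "(\<Sum>f\<in>B. scaleC (c f) f) \<in> complex_vector.span B"
    by (intro complex_vector.span_sum complex_vector.span_scale complex_vector.span_base)
  then show ?thesis
    using assms by (simp add: onb_of_def)
qed

lemma onb_of_projection:
  assumes "onb_of S B" "v \<in> S"
  shows "cinner v (u - (\<Sum>e\<in>B. scaleC (cinner e u) e)) = 0"
  by (rule onb_of_orthogonal[OF assms(1) _ assms(2)])
    (simp add: cinner_diff_right onb_of_cinner_sum[OF assms(1)])

lemma onb_of_expansion:
  assumes "onb_of S B" "v \<in> S"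
  shows "(\<Sum>e\<in>B. scaleC (cinner e v) e) = v"
proof -
  have "v - (\<Sum>e\<in>B. scaleC (cinner e v) e) \<in> S"
    using complex_vector.span_diff[of v B] assms onb_of_sum_in[OF assms(1)]
    by (simp add: onb_of_def)
  from onb_of_projection[OF assms(1) this, of v] show ?thesis
    by simp
qed

text \<open>Gram-Schmidt: the projection \<open>p\<close> onto the previous span is subtracted from
  the new generator, and the remainder is dropped if it vanishes and normalized otherwise.\<close>

lemma onb_of_span_exists:
  assumes "finite G"
  shows "\<exists>B. onb_of (complex_vector.span G) (B :: 'a::complex_hilbert set)"
  using assms
proof induction
  case empty
  show ?case
    by (rule exI[of _ "{}"]) (simp add: onb_of_def)
next
  case (insert b G)
  then obtain B where B: "onb_of (complex_vector.span G) B"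
    by blast
  define p where "p = (\<Sum>e\<in>B. scaleC (cinner e b) e)"
  have p: "p \<in> complex_vector.span G"
    unfolding p_def by (rule onb_of_sum_in[OF B])
  define r where "r = b - p"
  have r: "cinner e r = 0" if "e \<in> complex_vector.span G" for e
    unfolding r_def p_def by (rule onb_of_projection[OF B that])
  show ?case
  proof (cases "r = 0")
    case True
    then have "b \<in> complex_vector.span G"
      using p r_def by simp
    then have "complex_vector.span (insert b G) = complex_vector.span G"
      by (rule complex_vector.span_redundant)
    with B show ?thesis
      by auto
  next
    case False
    define f where "f = scaleC (complex_of_real (inverse (norm r))) r"
    have span_B: "complex_vector.span B = complex_vector.span G"
      using B by (simp add: onb_of_def)
    have ff: "cinner f f = 1"
      using False by (simp add: cinner_self f_def norm_scaleC norm_inverse)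
    have ef: "cinner e f = 0" if "e \<in> B" for e
      using r[of e] complex_vector.span_base[OF that] by (simp add: f_def cinner_simps span_B)
    have fe: "cinner f e = 0" if "e \<in> B" for e
      using ef[OF that] cinner_commute[of f e] by simp
    have b_eq: "b = scaleC (complex_of_real (norm r)) f + p"
      using False by (simp add: f_def r_def scaleC_scaleC scaleC_one flip: of_real_mult)
    have "complex_vector.span (insert f B) = complex_vector.span (insert b G)"
    proof (rule subset_antisym; rule complex_vector.span_minimal)
      have "p \<in> complex_vector.span (insert b G)"
        using p complex_vector.span_mono[of G "insert b G"] by blast
      then have "f \<in> complex_vector.span (insert b G)"
        unfolding f_def r_def
        by (intro complex_vector.span_scale complex_vector.span_diff
            complex_vector.span_base[of b]) auto
      moreover have "B \<subseteq> complex_vector.span (insert b G)"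
        using span_B complex_vector.span_superset[of B] complex_vector.span_mono[of G "insert b G"]
        by auto
      ultimately show "insert f B \<subseteq> complex_vector.span (insert b G)"
        by simp
      have "p \<in> complex_vector.span (insert f B)"
        using p span_B complex_vector.span_mono[of B "insert f B"] by blast
      then have "b \<in> complex_vector.span (insert f B)"
        by (subst b_eq) (intro complex_vector.span_scale complex_vector.span_add
            complex_vector.span_base[of f]; simp)
      moreover have "G \<subseteq> complex_vector.span (insert f B)"
        using span_B complex_vector.span_superset[of G] complex_vector.span_mono[of B "insert f B"]
        by auto
      ultimately show "insert b G \<subseteq> complex_vector.span (insert f B)"
        by simp
    qed simp_all
    then have "onb_of (complex_vector.span (insert b G)) (insert f B)"
      using B ff ef fe unfolding onb_of_def by auto
    then show ?thesis
      by blast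
  qed
qed

text \<open>\<open>cfinite_dim\<close> only places \<open>S\<close> inside the span of a finite set
  \<open>G\<close>. An independent subset of \<open>S\<close> cannot outnumber \<open>G\<close>, so
  a maximal one is a finite generating set, to which Gram-Schmidt applies.\<close>

lemma onb_of_exists:
  assumes "complex_vector.subspace S" "cfinite_dim S"
  obtains B where "onb_of S (B :: 'a::complex_hilbert set)"
proof -
  obtain G where G: "finite G" "S \<subseteq> complex_vector.span G"
    using assms(2) by (auto simp: cfinite_dim_def)
  obtain C where C: "C \<subseteq> S" "complex_vector.independent C" "S \<subseteq> complex_vector.span C"
    using complex_vector.maximal_independent_subset by blast
  have "finite C"
    using complex_vector.independent_span_bound[of G C] G C by auto
  moreover have "complex_vector.span C = S"
    using C assms(1) complex_vector.span_minimal by blast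
  ultimately show ?thesis
    using onb_of_span_exists that by metis
qed

text \<open>Expanding \<open>b\<close> in the basis picked by \<open>SOME\<close> collapses the sum,
  whichever basis that is. The given \<open>B\<close> guarantees that the choice really yields an
  orthonormal basis.\<close>

lemma trace_on_rank_one:
  assumes "onb_of S B" "b \<in> S" "\<And>v. v \<in> S \<Longrightarrow> T v = scaleC (c * cinner a v) b"
  shows "trace_on S T = c * cinner a b"
proof -
  define C where "C = (SOME B. onb_of S B)"
  have C: "onb_of S C"
    unfolding C_def by (rule someI) (rule assms(1))
  have "trace_on S T = (\<Sum>e\<in>C. cinner e (T e))"
    by (simp add: trace_on_def C_def)
  also have "\<dots> = (\<Sum>e\<in>C. c * cinner a (scaleC (cinner e b) e))"
  proof (rule sum.cong)
    fix e
    assume "e \<in> C"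
    then have "e \<in> S"
      using C complex_vector.span_base unfolding onb_of_def by blast
    then show "cinner e (T e) = c * cinner a (scaleC (cinner e b) e)"
      by (simp add: assms(3) cinner_scaleC_right)
  qed simp
  also have "\<dots> = c * cinner a b"
    unfolding sum_distrib_left[symmetric] cinner_sum_right[symmetric]
      onb_of_expansion[OF C assms(2)] ..
  finally show ?thesis .
qed

section \<open>Spin spaces\<close>

lemma selfadjointD: "selfadjoint x \<Longrightarrow> cinner (blinfun_apply x u) v = cinner u (blinfun_apply x v)"
  unfolding selfadjoint_def by blast

lemma clinear_op_iff: "clinear_op x \<longleftrightarrow> clinear (blinfun_apply x)"
  unfolding clinear_op_def clinear_iff by (metis blinfun.add_right)

lemma selfadjoint_scaleC:
  "selfadjoint x \<Longrightarrow> blinfun_apply x (scaleC c v) = scaleC c (blinfun_apply x v)"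
  unfolding selfadjoint_def clinear_op_def by blast

lemma subspace_spin_space: "selfadjoint x \<Longrightarrow> complex_vector.subspace (spin_space x)"
  unfolding spin_space_def
  by (rule module_hom.subspace_image[where ?s1.0 = scaleC])
    (simp_all add: selfadjoint_def clinear_op_iff flip: Vector_Spaces.linear_iff_module_hom)

lemma spin_space_onb:
  assumes "selfadjoint x" "finite_rank x"
  obtains B where "onb_of (spin_space x) B"
  using onb_of_exists[OF subspace_spin_space] assms by (auto simp: finite_rank_def spin_space_def)

lemma wave_eqI:
  assumes "selfadjoint x" "w \<in> spin_space x" "\<And>v. v \<in> spin_space x \<Longrightarrow> cinner v u = cinner v w"
  shows "wave x u = w"
  unfolding wave_def
proof (rule the_equality)
  show "w \<in> spin_space x \<and> (\<forall>v\<in>spin_space x. cinner v (u - w) = 0)"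
    using assms by (simp add: cinner_diff_right)
next
  fix w'
  assume w': "w' \<in> spin_space x \<and> (\<forall>v\<in>spin_space x. cinner v (u - w') = 0)"
  \<comment> \<open>The difference of two candidates lies in the spin space and is orthogonal to it,
    hence to itself.\<close>
  have "w' - w \<in> spin_space x"
    using complex_vector.subspace_diff[OF subspace_spin_space[OF assms(1)]] w' assms(2) by blast
  with w' assms(3) have "cinner (w' - w) (w' - w) = 0"
    by (metis cinner_diff_right right_minus_eq)
  then show "w' = w"
    by simp
qed

lemma
  assumes "selfadjoint x" "finite_rank x"
  shows wave_in [simp]: "wave x u \<in> spin_space x"
    and cinner_wave_right: "v \<in> spin_space x \<Longrightarrow> cinner v (wave x u) = cinner v u"
proof -
  obtain B where B: "onb_of (spin_space x) B"
    using spin_space_onb[OF assms] .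
  have eq: "wave x u = (\<Sum>e\<in>B. scaleC (cinner e u) e)"
    using onb_of_projection[OF B, of _ u]
    by (intro wave_eqI assms(1) onb_of_sum_in[OF B]) (simp add: cinner_diff_right)
  show "wave x u \<in> spin_space x"
    unfolding eq by (rule onb_of_sum_in[OF B])
  show "cinner v (wave x u) = cinner v u" if "v \<in> spin_space x"
    using onb_of_projection[OF B that, of u] by (simp add: eq cinner_diff_right)
qed

lemma cinner_wave_left:
  assumes "selfadjoint x" "finite_rank x" "v \<in> spin_space x"
  shows "cinner (wave x u) v = cinner u v"
  using cinner_wave_right[OF assms, of u] by (metis cinner_commute)

lemma apply_in_spin_space [simp]: "blinfun_apply x u \<in> spin_space x"
  by (simp add: spin_space_def)

lemma wave_id: "selfadjoint x \<Longrightarrow> v \<in> spin_space x \<Longrightarrow> wave x v = v"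
  by (rule wave_eqI) auto

lemma clinear_wave:
  assumes "selfadjoint x" "finite_rank x"
  shows "clinear (wave x)"
  unfolding clinear_iff
  by (auto intro!: wave_eqI complex_vector.subspace_add complex_vector.subspace_scale
      subspace_spin_space assms simp: cinner_simps cinner_wave_right assms)

text \<open>By selfadjointness, \<open>x\<close> vanishes on the orthogonal complement of its image,
  which absorbs the projection.\<close>

lemma apply_wave:
  assumes "selfadjoint x" "finite_rank x"
  shows "blinfun_apply x (wave x u) = blinfun_apply x u"
  by (rule eq_by_cinner)
    (simp only: cinner_wave_right[OF assms] apply_in_spin_space
      selfadjointD[OF assms(1), symmetric])

text \<open>The kernel of a selfadjoint operator is orthogonal to its image. This is the
  nondegeneracy of the spin inner product.\<close>

lemma inj_on_spin_space:
  assumes "selfadjoint x"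
  shows "inj_on (blinfun_apply x) (spin_space x)"
proof (rule inj_onI)
  fix v w
  assume vw: "v \<in> spin_space x" "w \<in> spin_space x" "blinfun_apply x v = blinfun_apply x w"
  have "v - w \<in> spin_space x"
    using complex_vector.subspace_diff[OF subspace_spin_space[OF assms]] vw by blast
  then obtain z where z: "v - w = blinfun_apply x z"
    by (auto simp: spin_space_def)
  have "cinner (v - w) (v - w) = cinner z (blinfun_apply x (v - w))"
    by (subst (1) z) (rule selfadjointD[OF assms])
  also have "\<dots> = 0"
    using vw by (simp add: blinfun.diff_right)
  finally show "v = w"
    by simp
qed

section \<open>The kernel P and adjoints with respect to the spin inner products\<close>

lemma spin_inner_cnj:
  "selfadjoint x \<Longrightarrow> cnj (spin_inner x u v) = spin_inner x v u"
  using selfadjointD[of x v u] cinner_commute[of u "blinfun_apply x v"]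
  by (simp add: spin_inner_def)

text \<open>The vector \<open>y v\<close> lies in the spin space, so pairing it with a projected
  vector is the same as pairing it with the vector itself; the sign is that of the spin inner
  product.\<close>

lemma wave_adj_eq:
  assumes "selfadjoint y" "finite_rank y"
  shows "wave_adj y v = - blinfun_apply y v"
proof -
  have "spin_inner y (wave y u) v = cinner u (- blinfun_apply y v)" for u
    by (simp add: spin_inner_def cinner_wave_left assms)
  then show ?thesis
    unfolding wave_adj_def by (intro the_equality) (auto intro: eq_by_cinner)
qed

lemma kernel_P_eq:
  assumes "selfadjoint x" "finite_rank x" "selfadjoint y" "finite_rank y"
  shows "kernel_P x y v = wave x (blinfun_apply y v)"
proof -
  interpret Vector_Spaces.linear scaleC scaleC "wave x"
    by (rule clinear_wave) (use assms in auto)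
  show ?thesis
    by (simp only: kernel_P_def wave_adj_eq[OF assms(3,4)] neg minus_minus)
qed

lemma spin_adj_eqI:
  assumes "selfadjoint y" "w \<in> spin_space y"
    and "\<And>u. u \<in> spin_space y \<Longrightarrow> spin_inner x (T u) v = spin_inner y u w"
  shows "spin_adj x y T v = w"
  unfolding spin_adj_def
proof (rule the_equality)
  show "w \<in> spin_space y \<and> (\<forall>u\<in>spin_space y. spin_inner x (T u) v = spin_inner y u w)"
    using assms by blast
next
  fix w'
  assume w': "w' \<in> spin_space y \<and> (\<forall>u\<in>spin_space y. spin_inner x (T u) v = spin_inner y u w')"
  \<comment> \<open>Both \<open>y w'\<close> and \<open>y w\<close> lie in the spin space, so
    testing against that space identifies them; injectivity of \<open>y\<close> on it then gives
    \<open>w' = w\<close>.\<close>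
  have "cinner u (blinfun_apply y w') = cinner u (blinfun_apply y w)" if "u \<in> spin_space y" for u
    using w' assms(3)[OF that] that by (simp add: spin_inner_def)
  then have "wave y (blinfun_apply y w') = blinfun_apply y w"
    by (intro wave_eqI assms) auto
  then have "blinfun_apply y w' = blinfun_apply y w"
    by (simp add: wave_id assms)
  then show "w' = w"
    using inj_on_spin_space[OF assms(1)] w' assms(2) by (auto dest: inj_onD)
qed

text \<open>The factors are moved across the inner product one by one, the projections being
  absorbed by \<open>x\<close> and \<open>y\<close>. It serves twice: for the varied kernel, with
  \<open>R\<close> a unitary exponential, and for its derivative, with \<open>R\<close> of rank at
  most one.\<close>

lemma spin_adj_compress:
  assumes "selfadjoint x" "finite_rank x" "selfadjoint y" "finite_rank y"
    and "\<And>a b. cinner (R a) b = cinner a (R' b)"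
    and "\<And>u. u \<in> spin_space y \<Longrightarrow> T u = wave x (R (blinfun_apply y u))"
  shows "spin_adj x y T v = wave y (R' (blinfun_apply x v))"
proof (rule spin_adj_eqI)
  fix u
  assume "u \<in> spin_space y"
  then show "spin_inner x (T u) v = spin_inner y u (wave y (R' (blinfun_apply x v)))"
    by (simp add: assms(5,6) spin_inner_def cinner_wave_left[OF assms(1,2)]
        apply_wave[OF assms(3,4)] selfadjointD[OF assms(3)])
qed (use assms in auto)

text \<open>\<open>Q x y\<close> is not given by a formula, so the adjoint of a general map is built
  by Riesz representation: \<open>z\<close> represents the antilinear functional sending
  \<open>u\<close> to \<open>cinner (T u) (x v)\<close>. Writing \<open>z = y z'\<close>, the
  adjoint is the projection of \<open>z'\<close>.\<close>

lemma spin_adj_exists: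
  assumes "selfadjoint x" "selfadjoint y" "finite_rank y" "T \<in> spin_maps x y" "u \<in> spin_space y"
  shows "spin_inner x (T u) v = spin_inner y u (spin_adj x y T v)"
proof -
  obtain B where B: "onb_of (spin_space y) B"
    using spin_space_onb assms by blast
  define z where "z = (\<Sum>e\<in>B. scaleC (cinner (T e) (blinfun_apply x v)) e)"
  obtain z' where z': "z = blinfun_apply y z'"
    unfolding z_def using onb_of_sum_in[OF B, unfolded spin_space_def, THEN rangeE] by metis
  have T0: "T 0 = 0"
    using assms(4,5) unfolding spin_maps_def
    by (metis (mono_tags, lifting) mem_Collect_eq complex_vector.scale_zero_left)
  have *: "spin_inner x (T u) v = spin_inner y u (wave y z')" if "u \<in> spin_space y" for u
  proof -
    have span_B: "complex_vector.span B = spin_space y"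
      using B by (simp add: onb_of_def)
    \<comment> \<open>Membership is carried through the induction because \<open>T\<close> is
      additive only on the spin space.\<close>
    have "u \<in> complex_vector.span B \<and> cinner (T u) (blinfun_apply x v) = cinner u z"
      using that[folded span_B]
    proof (induction rule: complex_vector.span_induct_alt)
      case base
      show ?case
        by (simp add: T0 complex_vector.span_zero)
    next
      case (step c e w)
      then have e: "e \<in> spin_space y" "scaleC c e \<in> spin_space y" "w \<in> spin_space y"
        unfolding span_B[symmetric]
        by (simp_all add: complex_vector.span_base complex_vector.span_scale)
      have "T (scaleC c e + w) = scaleC c (T e) + T w"
        using assms(4) e by (simp add: spin_maps_def)
      with step e show ?case
        by (simp add: cinner_simps z_def onb_of_cinner_sum[OF B] span_B
            complex_vector.subspace_add[OF subspace_spin_space[OF assms(2)]])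
    qed
    then show ?thesis
      by (simp add: spin_inner_def apply_wave assms z')
  qed
  have "spin_adj x y T v = wave y z'"
    by (rule spin_adj_eqI) (use assms * in auto)
  with *[OF assms(5)] show ?thesis
    by simp
qed

section \<open>Spectral invariance of the Lagrangian\<close>

lemma dim_image_inj_on:
  assumes "clinear f" "complex_vector.subspace S" "inj_on f S" "E \<subseteq> S"
  shows "complex_vector.dim (f ` E) = complex_vector.dim E"
proof -
  interpret f: Vector_Spaces.linear scaleC scaleC f
    by (rule assms(1))
  obtain B where B: "B \<subseteq> E" "complex_vector.independent B" "E \<subseteq> complex_vector.span B"
      "card B = complex_vector.dim E"
    by (rule complex_vector.basis_exists)
  have "complex_vector.span B \<subseteq> S"
    using B(1) assms(2,4) by (intro complex_vector.span_minimal) auto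
  then have inj: "inj_on f (complex_vector.span B)"
    using assms(3) inj_on_subset by blast
  have "card (f ` B) = complex_vector.dim (f ` E)"
  proof (rule complex_vector.basis_card_eq_dim)
    show "f ` B \<subseteq> f ` E" "f ` E \<subseteq> complex_vector.span (f ` B)"
      using B by (auto simp: f.span_image)
    show "complex_vector.independent (f ` B)"
      using B(2) inj by (rule f.independent_injective_image)
  qed
  moreover have "card (f ` B) = card B"
    using inj complex_vector.span_superset[of B] by (blast intro: card_image inj_on_subset)
  ultimately show ?thesis
    using B(4) by simp
qed

text \<open>Since \<open>f\<close> intertwines all powers of \<open>T - l\<close> and
  \<open>T' - l\<close>, it embeds one generalized eigenspace into the other; the hypothesis
  \<open>gen\<close> makes this embedding surjective.\<close>

lemma alg_mult_intertwine:
  assumes f: "clinear f" "inj_on f S" "f ` S \<subseteq> S'"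
    and S: "complex_vector.subspace S" "\<And>v. v \<in> S \<Longrightarrow> T v \<in> S"
    and fT: "\<And>v. v \<in> S \<Longrightarrow> f (T v) = T' (f v)"
    and gen: "\<And>v k. v \<in> S' \<Longrightarrow> ((\<lambda>w. T' w - scaleC l w) ^^ k) v = 0 \<Longrightarrow> v \<in> f ` S"
  shows "alg_mult S T l = alg_mult S' T' l"
proof -
  interpret f: Vector_Spaces.linear scaleC scaleC f
    by (rule f(1))
  let ?N = "\<lambda>w. T w - scaleC l w" and ?N' = "\<lambda>w. T' w - scaleC l w"
  have pow: "(?N ^^ k) v \<in> S \<and> f ((?N ^^ k) v) = (?N' ^^ k) (f v)" if "v \<in> S" for k v
  proof (induction k)
    case (Suc k)
    then show ?case
      using S by (simp add: f.diff f.scale fT complex_vector.subspace_diff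
          complex_vector.subspace_scale)
  qed (simp add: that)
  have zero: "f v = 0 \<longleftrightarrow> v = 0" if "v \<in> S" for v
    using inj_onD[OF f(2), of v 0] that complex_vector.subspace_0[OF S(1)] by auto
  have iff: "(?N' ^^ k) (f v) = 0 \<longleftrightarrow> (?N ^^ k) v = 0" if "v \<in> S" for k v
    using pow[OF that, of k] zero[of "(?N ^^ k) v"] by auto
  have "{v \<in> S'. \<exists>k. (?N' ^^ k) v = 0} = f ` {v \<in> S. \<exists>k. (?N ^^ k) v = 0}"
    (is "?E' = f ` ?E")
  proof (rule set_eqI)
    fix v
    have "v \<in> ?E' \<longleftrightarrow> v \<in> f ` S \<and> v \<in> ?E'"
      using gen by blast
    then show "v \<in> ?E' \<longleftrightarrow> v \<in> f ` ?E"
      using f(3) iff by blast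
  qed
  then show ?thesis
    unfolding alg_mult_def
    using dim_image_inj_on[OF f(1) S(1) f(2), of ?E] by auto
qed

lemma alg_mult_similar:
  assumes "clinear U" "\<And>v. V (U v) = v" "\<And>v. U (V v) = v" "\<And>v. U (T v) = T' (U v)"
  shows "alg_mult UNIV T l = alg_mult UNIV T' l"
proof (rule alg_mult_intertwine[OF assms(1)])
  show "inj U"
    using assms(2) by (rule inj_on_inverseI)
  show "v \<in> range U" for v
    using rangeI[of U "V v"] by (simp only: assms(3))
qed (simp_all add: assms(4))

text \<open>The intertwiner is \<open>x\<close> itself. Generalized eigenvectors of
  \<open>x R\<close> for \<open>l \<noteq> 0\<close> lie in the image of \<open>x\<close> by
  induction on the exponent, because \<open>l v\<close> is the difference of \<open>x (R v)\<close>
  and \<open>(x R - l) v\<close>.\<close>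

lemma alg_mult_compress:
  assumes x: "selfadjoint x" "finite_rank x" and "l \<noteq> 0"
  shows "alg_mult (spin_space x) (\<lambda>v. wave x (R (blinfun_apply x v))) l
       = alg_mult UNIV (\<lambda>v. blinfun_apply x (R v)) l"
proof (rule alg_mult_intertwine)
  let ?N = "\<lambda>w. blinfun_apply x (R w) - scaleC l w"
  note sub = subspace_spin_space[OF x(1)]
  fix v k
  assume "(?N ^^ k) v = 0"
  then have "v \<in> spin_space x"
  proof (induction k arbitrary: v)
    case 0
    then show ?case
      using complex_vector.subspace_0[OF sub] by simp
  next
    case (Suc k)
    then have "?N v \<in> spin_space x"
      by (simp only: funpow_Suc_right o_apply)
    then have "blinfun_apply x (R v) - ?N v \<in> spin_space x"
      by (rule complex_vector.subspace_diff[OF sub apply_in_spin_space])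
    then have "scaleC (inverse l) (scaleC l v) \<in> spin_space x"
      by (intro complex_vector.subspace_scale[OF sub, of "scaleC l v"]) simp
    then show ?case
      using \<open>l \<noteq> 0\<close> by (simp add: scaleC_scaleC scaleC_one)
  qed
  then obtain z where "v = blinfun_apply x z"
    by (auto simp: spin_space_def)
  then show "v \<in> blinfun_apply x ` spin_space x"
    using apply_wave[OF x, of z] wave_in[OF x, of z] by (metis image_eqI)
qed (use x in \<open>auto simp: apply_wave subspace_spin_space inj_on_spin_space selfadjoint_def
      simp flip: clinear_op_iff\<close>)

text \<open>The predicate under \<open>SOME\<close> sees only the multiplicities of non-zero
  numbers. If these agree, the predicates coincide and the choice returns literally the same list,
  in the same order.\<close>

lemma lagrangian_of_cong:
  assumes "\<And>l. l \<noteq> 0 \<Longrightarrow> alg_mult S T l = alg_mult S' T' l"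
  shows "lagrangian_of \<kappa> n S T = lagrangian_of \<kappa> n S' T'"
proof -
  have "eigenvalue_list m S T = eigenvalue_list m S' T'" for m
    unfolding eigenvalue_list_def using assms by (metis (no_types, lifting))
  then show ?thesis
    by (simp add: lagrangian_of_def)
qed

section \<open>Unitary variations generated by rank-one operators\<close>

lemma rank_one_apply [simp]: "blinfun_apply (rank_one u) v = scaleC (cinner u v) u"
  unfolding rank_one_def
    bounded_linear_Blinfun_apply[OF bounded_linear_compose[OF bounded_linear_scaleC_left
        bounded_linear_cinner_right]] ..

lemma scaleC_op_apply [simp]: "blinfun_apply (scaleC_op c T) v = scaleC c (blinfun_apply T v)"
  unfolding scaleC_op_def
    bounded_linear_Blinfun_apply[OF bounded_linear_compose[OF bounded_linear_scaleC_right
        blinfun.bounded_linear_right]] ..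

lemma selfadjoint_rank_one: "selfadjoint (rank_one u)"
  unfolding selfadjoint_def clinear_op_def
proof (intro conjI allI)
  fix v z
  show "cinner (blinfun_apply (rank_one u) v) z = cinner v (blinfun_apply (rank_one u) z)"
    using cinner_commute[of v u] by (simp add: cinner_simps)
qed (simp add: cinner_simps scaleC_scaleC)

lemma rank_one_in_jet_ops:
  assumes "complex_vector.subspace Hf" "u \<in> Hf"
  shows "rank_one u \<in> jet_ops Hf"
  using assms by (auto simp: jet_ops_def selfadjoint_rank_one complex_vector.subspace_scale)

text \<open>This allows the exponential series to be summed in the complex numbers and carried over
  to operators.\<close>

lemma bounded_linear_scaleC_op: "bounded_linear (\<lambda>c. scaleC_op c T)"
proof (rule bounded_linear_intro[where K = "norm T"])
  show "norm (scaleC_op c T) \<le> norm c * norm T" for c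
    by (rule norm_blinfun_bound)
      (auto simp: norm_scaleC mult.assoc intro!: mult_left_mono norm_blinfun)
qed (auto intro!: blinfun_eqI
    simp: blinfun.add_left blinfun.scaleR_left scaleC_add_left scaleR_scaleC scaleC_scaleC
      scaleR_conv_of_real)

text \<open>The nonzero eigenvalue of \<^term>\<open>rank_one w\<close>. For \<open>w = 0\<close> any nonzero number \<open>s\<close> satisfies
  \<open>A\<^sup>2 = s A\<close>; this choice avoids a division by zero.\<close>

definition rank_one_eigenvalue :: "'a::complex_hilbert \<Rightarrow> real" where
  "rank_one_eigenvalue w = (if w = 0 then 1 else (norm w)\<^sup>2)"

text \<open>With \<open>A = rank_one w\<close> and \<open>A^2 = s A\<close>, the exponential of
  \<open>c A\<close> is the identity plus a multiple of \<open>A\<close>. This is its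
  coefficient.\<close>

definition rank_one_exp_coeff :: "'a::complex_hilbert \<Rightarrow> complex \<Rightarrow> complex" where
  "rank_one_exp_coeff w c =
     (exp (c * of_real (rank_one_eigenvalue w)) - 1) / of_real (rank_one_eigenvalue w)"

lemma rank_one_eigenvalue_nonzero [simp]: "rank_one_eigenvalue w \<noteq> 0"
  by (simp add: rank_one_eigenvalue_def)

text \<open>The relation \<open>A^2 = s A\<close>, reduced to the vector \<open>w\<close>; for
  \<open>w = 0\<close> both sides vanish.\<close>

lemma rank_one_idem:
  "scaleC (cinner w w) w = scaleC (of_real (rank_one_eigenvalue w)) w"
  by (simp add: rank_one_eigenvalue_def cinner_self)

text \<open>The exponential series of \<open>c s\<close>, freed of its constant term and divided by
  \<open>s\<close>. The index 0 is set apart because \<open>k - 1\<close> is truncated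
  there.\<close>

lemma rank_one_exp_coeff_sums:
  "(\<lambda>k. if k = 0 then 0 else c ^ k * of_real (rank_one_eigenvalue w) ^ (k - 1) / fact k)
     sums rank_one_exp_coeff w c"
proof -
  let ?s = "of_real (rank_one_eigenvalue w) :: complex"
  have "(\<lambda>k. ((c * ?s) ^ k /\<^sub>R fact k - (if k = 0 then 1 else 0)) / ?s)
      sums ((exp (c * ?s) - 1) / ?s)"
    by (intro sums_divide sums_diff exp_converges sums_single[of 0 "\<lambda>_. 1"])
  moreover have "((c * ?s) ^ k /\<^sub>R fact k - (if k = 0 then 1 else 0)) / ?s
      = (if k = 0 then 0 else c ^ k * ?s ^ (k - 1) / fact k)" for k
  proof (cases k)
    case (Suc m)
    have "(c * ?s) ^ Suc m = c ^ Suc m * ?s ^ m * ?s"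
      by (simp add: power_mult_distrib)
    then show ?thesis
      by (simp add: Suc scaleR_conv_of_real divide_inverse del: power_Suc fact_Suc)
  qed simp
  ultimately show ?thesis
    by (simp add: rank_one_exp_coeff_def)
qed

lemma op_exp_rank_one:
  "op_exp (scaleC_op c (rank_one w))
     = id_blinfun + scaleC_op (rank_one_exp_coeff w c) (rank_one w)"
proof -
  let ?A = "rank_one w" and ?s = "of_real (rank_one_eigenvalue w) :: complex"
  let ?g = "\<lambda>k. if k = 0 then 0 else c ^ k * ?s ^ (k - 1) / fact k"
  \<comment> \<open>The powers are \<open>A^(k+1) = s^k A\<close>, so only the term of exponent 0
    involves the identity.\<close>
  have pow: "((\<lambda>B. scaleC_op c ?A o\<^sub>L B) ^^ Suc k) id_blinfun = scaleC_op (c ^ Suc k * ?s ^ k) ?A"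
    for k
  proof (induction k)
    case (Suc k)
    have "scaleC_op c ?A o\<^sub>L scaleC_op (c ^ Suc k * ?s ^ k) ?A
        = scaleC_op (c ^ Suc (Suc k) * ?s ^ Suc k) ?A"
    proof (rule blinfun_eqI)
      fix v
      have "blinfun_apply (scaleC_op c ?A o\<^sub>L scaleC_op (c ^ Suc k * ?s ^ k) ?A) v
          = scaleC (c * (c ^ Suc k * ?s ^ k) * cinner w v) (scaleC (cinner w w) w)"
        by (simp add: cinner_simps scaleC_scaleC mult_ac)
      also have "\<dots> = blinfun_apply (scaleC_op (c ^ Suc (Suc k) * ?s ^ Suc k) ?A) v"
        unfolding rank_one_idem by (simp add: scaleC_scaleC mult_ac)
      finally show "blinfun_apply (scaleC_op c ?A o\<^sub>L scaleC_op (c ^ Suc k * ?s ^ k) ?A) v = \<dots>" .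
    qed
    then show ?case
      using Suc by simp
  qed (auto intro!: blinfun_eqI)
  have "(\<lambda>k. (if k = 0 then id_blinfun else 0) + scaleC_op (?g k) ?A)
      sums (id_blinfun + scaleC_op (rank_one_exp_coeff w c) ?A)"
    by (intro sums_add sums_single[of 0 "\<lambda>_. id_blinfun"]
        bounded_linear.sums[OF bounded_linear_scaleC_op rank_one_exp_coeff_sums])
  moreover have "(if k = 0 then id_blinfun else 0) + scaleC_op (?g k) ?A
      = (1 / fact k) *\<^sub>R ((\<lambda>B. scaleC_op c ?A o\<^sub>L B) ^^ k) id_blinfun" for k
  proof (cases k)
    case 0
    then show ?thesis
      by (auto intro!: blinfun_eqI simp: blinfun.add_left)
  next
    case (Suc m)
    have "scaleC_op (?g (Suc m)) ?A = (1 / fact (Suc m)) *\<^sub>R scaleC_op (c ^ Suc m * ?s ^ m) ?A"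
      by (rule blinfun_eqI)
        (simp add: blinfun.scaleR_left scaleR_scaleC scaleC_scaleC del: fact_Suc)
    then show ?thesis
      unfolding Suc pow by simp
  qed
  ultimately have "(\<lambda>k. (1 / fact k) *\<^sub>R ((\<lambda>B. scaleC_op c ?A o\<^sub>L B) ^^ k) id_blinfun)
      sums (id_blinfun + scaleC_op (rank_one_exp_coeff w c) ?A)"
    by simp
  then show ?thesis
    unfolding op_exp_def by (rule sums_unique[symmetric])
qed

abbreviation rank_one_exp :: "'a::complex_hilbert \<Rightarrow> complex \<Rightarrow> 'a \<Rightarrow> 'a" where
  "rank_one_exp w c \<equiv> blinfun_apply (op_exp (scaleC_op c (rank_one w)))"

lemma rank_one_exp_apply:
  "rank_one_exp w c v = v + scaleC (rank_one_exp_coeff w c * cinner w v) w"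
  by (simp add: op_exp_rank_one blinfun.add_left scaleC_scaleC)

lemma clinear_rank_one_exp: "clinear (rank_one_exp w c)"
  unfolding clinear_iff
  by (simp add: rank_one_exp_apply cinner_simps scaleC_scaleC scaleC_add_right scaleC_add_left
      algebra_simps)

lemma rank_one_exp_inverse: "rank_one_exp w c (rank_one_exp w (- c) v) = v"
proof -
  let ?\<phi> = "rank_one_exp_coeff w" and ?s = "of_real (rank_one_eigenvalue w) :: complex"
  have "exp (c * ?s) * exp (- (c * ?s)) = 1"
    by (simp flip: exp_add)
  \<comment> \<open>The coefficient of \<open>A\<close> in the product of the two exponentials; its
    vanishing restates that the scalar exponentials are inverse to each other.\<close>
  then have zero: "?\<phi> (- c) + ?\<phi> c + ?s * ?\<phi> c * ?\<phi> (- c) = 0"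
    unfolding rank_one_exp_coeff_def
    by (simp add: divide_simps del: exp_minus) (simp add: algebra_simps)
  have "rank_one_exp w c (rank_one_exp w (- c) v)
      = v + scaleC ((?\<phi> (- c) + ?\<phi> c) * cinner w v) w
          + scaleC (?\<phi> c * ?\<phi> (- c) * cinner w v) (scaleC (cinner w w) w)"
    by (simp add: rank_one_exp_apply cinner_simps scaleC_scaleC scaleC_add_left algebra_simps)
  also have "\<dots> = v + scaleC ((?\<phi> (- c) + ?\<phi> c + ?s * ?\<phi> c * ?\<phi> (- c)) * cinner w v) w"
    unfolding rank_one_idem by (simp add: scaleC_scaleC scaleC_add_left algebra_simps)
  finally show ?thesis
    by (simp add: zero)
qed

text \<open>\<open>A\<close> is selfadjoint and its coefficient is compatible with conjugation. For
  imaginary \<open>c\<close> the conjugate is \<open>- c\<close>, so the adjoint is the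
  inverse.\<close>

lemma cinner_rank_one_exp: "cinner (rank_one_exp w c u) v = cinner u (rank_one_exp w (cnj c) v)"
proof -
  have "cnj (rank_one_exp_coeff w c) = rank_one_exp_coeff w (cnj c)"
    by (simp add: rank_one_exp_coeff_def exp_cnj)
  then show ?thesis
    using cinner_commute[of u w] by (simp add: rank_one_exp_apply cinner_simps)
qed

lemma has_vector_derivative_rank_one_exp_coeff:
  "((\<lambda>\<tau>. rank_one_exp_coeff w (- \<i> * of_real \<tau>)) has_vector_derivative - \<i>) (at 0)"
proof -
  have "((\<lambda>z. rank_one_exp_coeff w (- \<i> * z)) has_field_derivative - \<i>) (at (of_real 0))"
    unfolding rank_one_exp_coeff_def by (auto intro!: derivative_eq_intros)
  then show ?thesis
    by (rule has_vector_derivative_real_field)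
qed

section \<open>The Lagrangian under unitary variations\<close>

lemma unitary_var_apply:
  "blinfun_apply (unitary_var (rank_one w) \<tau> x) v
     = rank_one_exp w (\<i> * of_real \<tau>) (blinfun_apply x (rank_one_exp w (- (\<i> * of_real \<tau>)) v))"
  by (simp add: unitary_var_def)

lemma lagrangian_unitary_var_left:
  assumes x: "selfadjoint x" "finite_rank x" and y: "selfadjoint y" "finite_rank y"
  shows "lagrangian \<kappa> n (unitary_var (rank_one w) \<tau> x) y
       = lagrangian_P \<kappa> n x y (\<lambda>v. wave x (rank_one_exp w (- (\<i> * of_real \<tau>)) (blinfun_apply y v)))"
proof -
  let ?U = "rank_one_exp w (\<i> * of_real \<tau>)" and ?V = "rank_one_exp w (- (\<i> * of_real \<tau>))"
  let ?p = "\<lambda>v. wave x (?V (blinfun_apply y v))"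
  \<comment> \<open>The adjoint of \<open>?V\<close> is \<open>?U\<close>, so the spin adjoint of
    \<open>?p\<close> is \<open>?U\<close> after \<open>x\<close>, projected to the spin space of
    \<open>y\<close>; the \<open>y\<close> inside \<open>?p\<close> absorbs that projection.\<close>
  have p: "(?p \<circ> spin_adj x y ?p)
      = (\<lambda>v. wave x ((\<lambda>z. ?V (blinfun_apply y (?U z))) (blinfun_apply x v)))"
    unfolding fun_eq_iff
    by (simp add: spin_adj_compress[OF x y cinner_rank_one_exp] apply_wave[OF y])
  show ?thesis
    unfolding lagrangian_P_def lagrangian_def p
  proof (rule lagrangian_of_cong[symmetric])
    fix l :: complex
    assume "l \<noteq> 0"
    from alg_mult_compress[OF x this]
    have "alg_mult (spin_space x)
        (\<lambda>v. wave x ((\<lambda>z. ?V (blinfun_apply y (?U z))) (blinfun_apply x v))) l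
      = alg_mult UNIV (\<lambda>v. blinfun_apply x (?V (blinfun_apply y (?U v)))) l" .
    \<comment> \<open>Conjugation with \<open>?U\<close>, as U (x V y U) = (U x V) y U.\<close>
    also have "\<dots> = alg_mult UNIV (blinfun_apply (unitary_var (rank_one w) \<tau> x o\<^sub>L y)) l"
      by (rule alg_mult_similar[OF clinear_rank_one_exp, where V = ?V])
        (use rank_one_exp_inverse[of "- (\<i> * of_real \<tau>)" w] in
          \<open>simp_all add: rank_one_exp_inverse unitary_var_apply\<close>)
    finally show "alg_mult (spin_space x)
        (\<lambda>v. wave x ((\<lambda>z. ?V (blinfun_apply y (?U z))) (blinfun_apply x v))) l = \<dots>" .
  qed
qed

text \<open>With U and V the exponentials for \<open>\<tau>\<close> and \<open>- \<tau>\<close>,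
  conjugation with V takes x U y V to V x U y.\<close>

lemma lagrangian_unitary_var_right:
  "lagrangian \<kappa> n x (unitary_var (rank_one w) \<tau> y)
     = lagrangian \<kappa> n (unitary_var (rank_one w) (- \<tau>) x) y"
  unfolding lagrangian_def
proof (rule lagrangian_of_cong, rule alg_mult_similar[OF clinear_rank_one_exp])
  let ?U = "rank_one_exp w (\<i> * of_real \<tau>)"
  show "?U (rank_one_exp w (- (\<i> * of_real \<tau>)) v) = v" for v
    by (rule rank_one_exp_inverse)
  show "rank_one_exp w (- (\<i> * of_real \<tau>)) (?U v) = v" for v
    using rank_one_exp_inverse[of "- (\<i> * of_real \<tau>)" w] by simp
qed (simp add: unitary_var_apply)

section \<open>The surface density in terms of the kernel \<open>Q\<close>\<close>

text \<open>The integrand of the claim before antisymmetrization in the two points, isolated as a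
  sesquilinear form to which polarization applies.\<close>

definition spin_form ::
  "(('a::complex_hilbert \<Rightarrow>\<^sub>L 'a) \<Rightarrow> ('a \<Rightarrow>\<^sub>L 'a) \<Rightarrow> 'a \<Rightarrow> 'a) \<Rightarrow> 'a \<Rightarrow> 'a \<Rightarrow>
     ('a \<Rightarrow>\<^sub>L 'a) \<Rightarrow> ('a \<Rightarrow>\<^sub>L 'a) \<Rightarrow> complex" where
  "spin_form Q u v x y = spin_inner x (wave x u) (Q x y (wave y v))"

lemma D1_lagrangian_rank_one:
  assumes x: "selfadjoint x" "finite_rank x" and y: "selfadjoint y" "finite_rank y"
    and Q: "is_kernel_Q \<kappa> n \<rho> Q" "x \<in> supp \<rho>" "y \<in> supp \<rho>"
    and diff: "(\<lambda>\<tau>. lagrangian \<kappa> n (unitary_var (rank_one w) \<tau> x) y) differentiable (at 0)"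
  shows "D1_lagrangian \<kappa> n (rank_one w) x y = 2 * Im (spin_form Q w w x y)"
proof -
  have Qxy: "Q x y \<in> spin_maps x y"
    and var: "\<And>p dP dL.
        (\<forall>\<tau>. p \<tau> \<in> spin_maps x y) \<Longrightarrow> (\<forall>v\<in>spin_space y. p 0 v = kernel_P x y v) \<Longrightarrow>
        (\<forall>v\<in>spin_space y. ((\<lambda>\<tau>. p \<tau> v) has_vector_derivative dP v) (at 0)) \<Longrightarrow>
        ((\<lambda>\<tau>::real. lagrangian_P \<kappa> n x y (p \<tau>)) has_real_derivative dL) (at 0) \<Longrightarrow>
        dL = 2 * Re (trace_on (spin_space x) (Q x y \<circ> spin_adj x y dP))"
    using Q unfolding is_kernel_Q_def by blast+
  interpret wx: Vector_Spaces.linear scaleC scaleC "wave x"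
    by (rule clinear_wave[OF x])
  interpret wy: Vector_Spaces.linear scaleC scaleC "wave y"
    by (rule clinear_wave[OF y])
  define p where "p \<tau> v = wave x (rank_one_exp w (- (\<i> * of_real \<tau>)) (blinfun_apply y v))"
    for \<tau> v
  \<comment> \<open>The derivative of \<open>p\<close> at 0, in which the exponential contributes
    \<open>- \<i>\<close> times \<open>rank_one w\<close>.\<close>
  define dP where "dP v = scaleC (- \<i> * cinner w (blinfun_apply y v)) (wave x w)" for v
  have p_eq: "p \<tau> v = wave x (blinfun_apply y v) +
      scaleC (rank_one_exp_coeff w (- \<i> * of_real \<tau>)) (scaleC (cinner w (blinfun_apply y v)) (wave x w))"
    for \<tau> v
    by (simp add: p_def rank_one_exp_apply wx.add wx.scale scaleC_scaleC)
  have "D1_lagrangian \<kappa> n (rank_one w) x y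
      = 2 * Re (trace_on (spin_space x) (Q x y \<circ> spin_adj x y dP))"
  proof (rule var)
    show "\<forall>\<tau>. p \<tau> \<in> spin_maps x y"
      by (auto simp: spin_maps_def p_eq blinfun.add_right selfadjoint_scaleC y wx.add wx.scale
          cinner_simps scaleC_add_left scaleC_add_right scaleC_scaleC algebra_simps
          intro!: complex_vector.subspace_add complex_vector.subspace_scale subspace_spin_space x wave_in)
    show "\<forall>v\<in>spin_space y. p 0 v = kernel_P x y v"
      by (simp add: p_eq kernel_P_eq x y rank_one_exp_coeff_def)
    show "\<forall>v\<in>spin_space y. ((\<lambda>\<tau>. p \<tau> v) has_vector_derivative dP v) (at 0)"
    proof
      fix v
      let ?z = "scaleC (cinner w (blinfun_apply y v)) (wave x w)"
      have "((\<lambda>\<tau>. scaleC (rank_one_exp_coeff w (- \<i> * of_real \<tau>)) ?z)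
          has_vector_derivative scaleC (- \<i>) ?z) (at 0)"
        by (rule bounded_linear.has_vector_derivative[OF bounded_linear_scaleC_left
              has_vector_derivative_rank_one_exp_coeff])
      from has_vector_derivative_add[OF has_vector_derivative_const this]
      show "((\<lambda>\<tau>. p \<tau> v) has_vector_derivative dP v) (at 0)"
        by (simp add: p_eq dP_def scaleC_scaleC)
    qed
    \<comment> \<open>Identifying the two Lagrangians for all \<open>\<tau>\<close> lets
      \<open>diff\<close> supply the first variation that the defining property of \<open>Q\<close>
      requires.\<close>
    have "lagrangian_P \<kappa> n x y (p \<tau>) = lagrangian \<kappa> n (unitary_var (rank_one w) \<tau> x) y" for \<tau>
      unfolding p_def by (rule lagrangian_unitary_var_left[OF x y, symmetric])
    then show "((\<lambda>\<tau>. lagrangian_P \<kappa> n x y (p \<tau>)) has_real_derivative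
        D1_lagrangian \<kappa> n (rank_one w) x y) (at 0)"
      using diff by (simp add: D1_lagrangian_def real_differentiable_def DERIV_deriv_iff_has_field_derivative)
  qed
  also have "trace_on (spin_space x) (Q x y \<circ> spin_adj x y dP)
      = \<i> * cinner (blinfun_apply x w) (Q x y (wave y w))"
  proof -
    obtain B where B: "onb_of (spin_space x) B"
      using spin_space_onb[OF x] .
    \<comment> \<open>Taking the adjoint turns \<open>- \<i>\<close> into \<open>\<i>\<close> and
      leaves a map into the line of \<open>wave y w\<close>, so that the trace reduces to one inner
      product.\<close>
    have adj: "spin_adj x y dP v = scaleC (\<i> * cinner (blinfun_apply x w) v) (wave y w)" for v
    proof -
      have "spin_adj x y dP v
          = wave y ((\<lambda>z. scaleC (\<i> * cinner w z) w) (blinfun_apply x v))"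
      proof (rule spin_adj_compress[OF x y, where R = "\<lambda>z. scaleC (- \<i> * cinner w z) w"])
        show "cinner (scaleC (- \<i> * cinner w a) w) b = cinner a (scaleC (\<i> * cinner w b) w)" for a b
          using cinner_commute[of a w] by (simp add: cinner_simps)
      qed (simp add: dP_def wx.scale wx.neg)
      then show ?thesis
        by (simp add: wy.scale selfadjointD[OF x(1)])
    qed
    have "Q x y (scaleC c (wave y w)) = scaleC c (Q x y (wave y w))" for c
      using Qxy y by (simp add: spin_maps_def)
    then have "(Q x y \<circ> spin_adj x y dP) v
        = scaleC (\<i> * cinner (blinfun_apply x w) v) (Q x y (wave y w))" for v
      by (simp add: adj)
    moreover have "Q x y (wave y w) \<in> spin_space x"
      using Qxy wave_in[OF y, of w] by (auto simp: spin_maps_def)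
    ultimately show ?thesis
      by (intro trace_on_rank_one[OF B])
  qed
  also have "cinner (blinfun_apply x w) (Q x y (wave y w)) = - spin_form Q w w x y"
    by (simp add: spin_form_def spin_inner_def cinner_wave_left x selfadjointD)
  finally show ?thesis
    by simp
qed

text \<open>The Lagrangian depends only on the relative unitary variation of its two arguments, so that
  varying the second argument amounts to varying the first one backwards.\<close>

lemma D2_lagrangian_rank_one:
  assumes "(\<lambda>\<tau>. lagrangian \<kappa> n (unitary_var (rank_one w) \<tau> x) y) differentiable (at 0)"
  shows "D2_lagrangian \<kappa> n (rank_one w) x y = - D1_lagrangian \<kappa> n (rank_one w) x y"
proof -
  let ?f = "\<lambda>\<tau>. lagrangian \<kappa> n (unitary_var (rank_one w) \<tau> x) y"
  have "(?f has_real_derivative D1_lagrangian \<kappa> n (rank_one w) x y) (at (- 0))"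
    using assms by (simp add: D1_lagrangian_def real_differentiable_def DERIV_deriv_iff_has_field_derivative)
  then have "((\<lambda>\<tau>. ?f (- \<tau>)) has_real_derivative - D1_lagrangian \<kappa> n (rank_one w) x y) (at 0)"
    by (rule DERIV_mirror[where f = ?f, THEN iffD1])
  then show ?thesis
    unfolding D2_lagrangian_def lagrangian_unitary_var_right by (rule DERIV_imp_deriv)
qed

text \<open>Moving \<open>Q x y\<close> to the other side of the spin inner product turns it into
  \<open>Q y x\<close>, by the symmetry of the kernel.\<close>

lemma spin_form_cnj:
  assumes x: "selfadjoint x" "finite_rank x" and y: "selfadjoint y" "finite_rank y"
    and "Q x y \<in> spin_maps x y"
    and "\<And>v. v \<in> spin_space x \<Longrightarrow> spin_adj x y (Q x y) v = Q y x v"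
  shows "cnj (spin_form Q u v x y) = spin_form Q v u y x"
  by (simp add: spin_form_def spin_inner_cnj x y assms(6)
      spin_adj_exists[OF x(1) y assms(5)])

section \<open>Sesquilinearity of the form, and polarization\<close>

lemma spin_form_add_left:
  assumes "selfadjoint x" "finite_rank x"
  shows "spin_form Q (u + u') v x y = spin_form Q u v x y + spin_form Q u' v x y"
proof -
  interpret Vector_Spaces.linear scaleC scaleC "wave x"
    by (rule clinear_wave[OF assms])
  show ?thesis
    by (simp add: spin_form_def spin_inner_def add cinner_simps)
qed

lemma spin_form_scaleC_left:
  assumes "selfadjoint x" "finite_rank x"
  shows "spin_form Q (scaleC c u) v x y = cnj c * spin_form Q u v x y"
proof -
  interpret Vector_Spaces.linear scaleC scaleC "wave x"
    by (rule clinear_wave[OF assms])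
  show ?thesis
    by (simp add: spin_form_def spin_inner_def scale cinner_simps)
qed

lemma spin_form_add_right:
  assumes "selfadjoint y" "finite_rank y" "Q x y \<in> spin_maps x y"
  shows "spin_form Q u (v + v') x y = spin_form Q u v x y + spin_form Q u v' x y"
proof -
  interpret Vector_Spaces.linear scaleC scaleC "wave y"
    by (rule clinear_wave[OF assms(1,2)])
  have "Q x y (wave y (v + v')) = Q x y (wave y v) + Q x y (wave y v')"
    using assms by (simp add: add spin_maps_def)
  then show ?thesis
    by (simp add: spin_form_def spin_inner_def cinner_simps blinfun.add_right)
qed

lemma spin_form_scaleC_right:
  assumes "selfadjoint x" "selfadjoint y" "finite_rank y" "Q x y \<in> spin_maps x y"
  shows "spin_form Q u (scaleC c v) x y = c * spin_form Q u v x y"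
proof -
  interpret Vector_Spaces.linear scaleC scaleC "wave y"
    by (rule clinear_wave[OF assms(2,3)])
  have "Q x y (wave y (scaleC c v)) = scaleC c (Q x y (wave y v))"
    using assms by (simp add: scale spin_maps_def)
  then show ?thesis
    by (simp add: spin_form_def spin_inner_def cinner_simps selfadjoint_scaleC assms(1))
qed

lemma polarization:
  fixes B :: "'a::complex_hilbert \<Rightarrow> 'a \<Rightarrow> complex"
  assumes add: "\<And>u u' v. B (u + u') v = B u v + B u' v" "\<And>u v v'. B u (v + v') = B u v + B u v'"
    and scale: "\<And>c u v. B (scaleC c u) v = cnj c * B u v" "\<And>c u v. B u (scaleC c v) = c * B u v"
  shows "1 / 4 * (B (u + v) (u + v) - B (u - v) (u - v))
       - \<i> / 4 * (B (u + scaleC \<i> v) (u + scaleC \<i> v) - B (u - scaleC \<i> v) (u - scaleC \<i> v)) = B u v"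
proof -
  \<comment> \<open>With differences written as sums, additivity and homogeneity suffice to expand
    all four terms.\<close>
  have "z - z' = z + scaleC (- 1) z'" for z z' :: 'a
    by (simp add: scaleC_one)
  then show ?thesis
    by (simp only: add scale) (simp add: algebra_simps)
qed

section \<open>Double integrals over the surface layer\<close>

text \<open>Local finiteness covers \<open>F\<close> by relatively open sets of finite measure.
  Second countability gives the Lindelof property and thus a countable subcover, whose members are
  measurable for the trace of the Borel sets.\<close>

lemma locally_finite_imp_sigma_finite:
  assumes "locally_finite_regular F \<rho>" "second_countable (top_of_set F)"
  shows "sigma_finite_measure \<rho>"
proof
  have sets: "sets \<rho> = sets (restrict_space borel F)"
    using assms(1) by (simp add: locally_finite_regular_def)
  then have space: "space \<rho> = F"
    by (auto dest: sets_eq_imp_space_eq simp: space_restrict_space)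
  let ?\<U> = "{U. openin (top_of_set F) U \<and> emeasure \<rho> U < \<infinity>}"
  have "F \<subseteq> \<Union>?\<U>"
    using assms(1) unfolding locally_finite_regular_def by blast
  moreover have "Lindelof_space (top_of_set F)"
    using assms(2) by (rule second_countable_imp_Lindelof_space)
  ultimately have "\<exists>\<V>. countable \<V> \<and> \<V> \<subseteq> ?\<U> \<and> topspace (top_of_set F) \<subseteq> \<Union>\<V>"
    unfolding Lindelof_space_alt by (elim allE[of _ ?\<U>], elim impE) simp_all
  then obtain \<V> where \<V>: "countable \<V>" "\<V> \<subseteq> ?\<U>" "F \<subseteq> \<Union>\<V>"
    by auto
  have open_sets: "U \<in> sets \<rho>" "U \<subseteq> F" if "openin (top_of_set F) U" for U
    using that openin_subset[OF that] by (auto simp: sets sets_restrict_space openin_open)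
  show "\<exists>A. countable A \<and> A \<subseteq> sets \<rho> \<and> \<Union>A = space \<rho> \<and> (\<forall>a\<in>A. emeasure \<rho> a \<noteq> \<infinity>)"
  proof (intro exI conjI ballI)
    show "countable \<V>" "\<V> \<subseteq> sets \<rho>"
      using \<V> open_sets(1) by blast+
    show "\<Union>\<V> = space \<rho>"
      unfolding space using \<V> open_sets(2) by blast
    show "emeasure \<rho> U \<noteq> \<infinity>" if "U \<in> \<V>" for U
      using \<V>(2) that by (auto simp: less_top)
  qed
qed

text \<open>Tonelli turns the finite iterated integral of the absolute value into integrability on
  the product; Fubini then equates the two integrals.\<close>

lemma (in sigma_finite_measure) double_integral_finite_Fubini:
  assumes "double_integral_finite M X Y f"
  shows "set_integrable (M \<Otimes>\<^sub>M M) (X \<times> Y) (\<lambda>(x, y). f x y)"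
    and "(LINT x:X|M. LINT y:Y|M. f x y) = (LINT (x, y):X \<times> Y|M \<Otimes>\<^sub>M M. f x y)"
proof -
  interpret P: pair_sigma_finite M M
    by unfold_locales
  let ?g = "\<lambda>(x, y). indicator (X \<times> Y) (x, y) *\<^sub>R f x y :: real"
  have g_eq: "(\<lambda>p. indicator (X \<times> Y) p *\<^sub>R (case p of (x, y) \<Rightarrow> f x y)) = ?g"
    by auto
  have meas: "?g \<in> borel_measurable (M \<Otimes>\<^sub>M M)"
    using assms unfolding double_integral_finite_def set_borel_measurable_def g_eq by blast
  have "(\<integral>\<^sup>+p. ennreal (norm (?g p)) \<partial>(M \<Otimes>\<^sub>M M)) = (\<integral>\<^sup>+x. \<integral>\<^sup>+y. ennreal (norm (?g (x, y))) \<partial>M \<partial>M)"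
    by (rule nn_integral_fst[symmetric])
      (intro measurable_compose[OF measurable_compose[OF meas borel_measurable_norm]
          measurable_ennreal])
  also have "\<dots> = (\<integral>\<^sup>+x\<in>X. (\<integral>\<^sup>+y\<in>Y. ennreal \<bar>f x y\<bar> \<partial>M) \<partial>M)"
  proof (rule nn_integral_cong)
    fix x
    show "(\<integral>\<^sup>+y. ennreal (norm (?g (x, y))) \<partial>M)
        = (\<integral>\<^sup>+y. ennreal \<bar>f x y\<bar> * indicator Y y \<partial>M) * indicator X x"
      by (cases "x \<in> X") (auto intro!: nn_integral_cong split: split_indicator)
  qed
  also have "\<dots> < \<infinity>"
    using assms by (simp add: double_integral_finite_def)
  finally have int: "integrable (M \<Otimes>\<^sub>M M) ?g"
    by (intro integrableI_bounded meas)
  then show "set_integrable (M \<Otimes>\<^sub>M M) (X \<times> Y) (\<lambda>(x, y). f x y)"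
    unfolding set_integrable_def g_eq .
  have "(LINT x:X|M. LINT y:Y|M. f x y) = (LINT x|M. LINT y|M. ?g (x, y))"
    unfolding set_lebesgue_integral_def
    by (intro Bochner_Integration.integral_cong) (simp_all add: indicator_times mult.assoc)
  also have "\<dots> = integral\<^sup>L (M \<Otimes>\<^sub>M M) ?g"
    using int by (rule P.integral_fst')
  finally show "(LINT x:X|M. LINT y:Y|M. f x y) = (LINT (x, y):X \<times> Y|M \<Otimes>\<^sub>M M. f x y)"
    unfolding set_lebesgue_integral_def g_eq .
qed

section \<open>The surface layer integral and its polarization\<close>

lemma surface_density_rank_one:
  assumes regular: "supp \<rho> \<subseteq> regular_ops n"
    and Hf: "complex_vector.subspace Hf" and w: "w \<in> Hf"
    and diff: "jet_derivatives_exist \<kappa> n \<rho> Hf" and Q: "is_kernel_Q \<kappa> n \<rho> Q"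
    and x: "x \<in> supp \<rho>" and y: "y \<in> supp \<rho>"
  shows
    "complex_of_real (surface_density \<kappa> n (rank_one w) x y)
       = - 2 * \<i> * (spin_form Q w w x y - spin_form Q w w y x)"
proof -
  have Qxy: "Q x y \<in> spin_maps x y"
    and sym: "\<And>v. v \<in> spin_space x \<Longrightarrow> spin_adj x y (Q x y) v = Q y x v"
    using Q x y unfolding is_kernel_Q_def by blast+
  have d: "(\<lambda>\<tau>. lagrangian \<kappa> n (unitary_var (rank_one w) \<tau> x) y) differentiable (at 0)"
    using diff rank_one_in_jet_ops[OF Hf w] x y unfolding jet_derivatives_exist_def by blast
  have ops: "selfadjoint x" "finite_rank x" "selfadjoint y" "finite_rank y"
    using regular x y by (auto simp: regular_ops_def)
  have "surface_density \<kappa> n (rank_one w) x y = 4 * Im (spin_form Q w w x y)"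
    unfolding surface_density_def D2_lagrangian_rank_one[OF d]
      D1_lagrangian_rank_one[OF ops Q x y d] by simp
  \<comment> \<open>The difference of a number and its conjugate is \<open>2 * \<i>\<close> times
    its imaginary part, so the factor \<open>- 2 * \<i>\<close> produces the 4 found above.\<close>
  moreover have "spin_form Q w w y x = cnj (spin_form Q w w x y)"
    by (rule spin_form_cnj[OF ops Qxy sym, symmetric])
  ultimately show ?thesis
    by (simp add: complex_eq_iff)
qed

theorem proposition3p11:
  fixes F :: "('a::complex_hilbert \<Rightarrow>\<^sub>L 'a) set"
    and \<rho> :: "('a \<Rightarrow>\<^sub>L 'a) measure"
    and Hf :: "'a set"
    and \<Omega> \<Omega>0 :: "('a \<Rightarrow>\<^sub>L 'a) set"
    and Q :: "('a \<Rightarrow>\<^sub>L 'a) \<Rightarrow> ('a \<Rightarrow>\<^sub>L 'a) \<Rightarrow> 'a \<Rightarrow> 'a"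
    and n :: nat and \<kappa> :: real and u v :: 'a
  assumes "1 \<le> n" and "0 < \<kappa>"
    and "\<exists>k. smooth_submanifold k F"
    and "F \<subseteq> regular_ops n"
    and "\<exists>c. \<forall>x\<in>F. op_trace x = c"
    and "locally_finite_regular F \<rho>"
    and "weak_EL \<kappa> n F \<rho>"
    and "complex_vector.subspace Hf" and "cfinite_dim Hf"
    and "\<forall>A\<in>jet_ops Hf. \<forall>x\<in>F. commutator_jet A x \<in> tangent_space F x"
    and "jet_derivatives_exist \<kappa> n \<rho> Hf"
    and "time_oriented \<kappa> n \<rho> Hf \<Omega>0"
    and "is_kernel_Q \<kappa> n \<rho> Q"
    and "\<Omega> \<in> past_sets \<kappa> n \<rho> Hf \<Omega>0"
    and "u \<in> Hf" and "v \<in> Hf"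
  shows "set_integrable (\<rho> \<Otimes>\<^sub>M \<rho>) (\<Omega> \<times> (supp \<rho> - \<Omega>))
           (\<lambda>(x, y). spin_inner x (wave x u) (Q x y (wave y v))
                   - spin_inner y (wave y u) (Q y x (wave x v)))
       \<and> commutator_inner \<kappa> n \<rho> \<Omega> u v =
           - 2 * \<i> * (LINT (x, y):\<Omega> \<times> (supp \<rho> - \<Omega>)|\<rho> \<Otimes>\<^sub>M \<rho>.
              (spin_inner x (wave x u) (Q x y (wave y v))
             - spin_inner y (wave y u) (Q y x (wave x v))))"
proof -
  note F_regular = assms(4) and \<rho> = assms(6) and Hf = assms(8) and diff = assms(11)
    and Q = assms(13) and uv = assms(15,16)
  define Y where "Y = supp \<rho> - \<Omega>"
  interpret sigma_finite_measure \<rho>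
    using locally_finite_imp_sigma_finite[OF \<rho>] assms(3) unfolding smooth_submanifold_def by blast
  have "space \<rho> = F"
    using \<rho> by (auto simp: locally_finite_regular_def space_restrict_space
        dest!: sets_eq_imp_space_eq)
  then have regular: "supp \<rho> \<subseteq> regular_ops n"
    using F_regular by (auto simp: supp_def)
  then have sa: "\<And>x. x \<in> supp \<rho> \<Longrightarrow> selfadjoint x" and fr: "\<And>x. x \<in> supp \<rho> \<Longrightarrow> finite_rank x"
    by (auto simp: regular_ops_def)
  \<comment> \<open>Causal equivalence relates only surface layer finite sets, so a past set is one;
    this supplies all integrability below.\<close>
  have slf: "\<Omega> \<in> surface_layer_finite \<kappa> n \<rho> Hf"
    using assms(14) by (simp add: past_sets_def causally_equivalent_def)
  then have \<Omega>: "\<Omega> \<subseteq> supp \<rho>"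
    by (simp add: surface_layer_finite_def)
  let ?B = "\<lambda>u v x y. spin_form Q u v x y - spin_form Q u v y x"
  \<comment> \<open>The density is cut off by an indicator and made complex, so that polarization
    becomes a linear combination of integrable functions on one product space.\<close>
  define G where "G w p = complex_of_real (indicator (\<Omega> \<times> Y) p *\<^sub>R
    (case p of (x, y) \<Rightarrow> surface_density \<kappa> n (rank_one w) x y))" for w p
  have G: "integrable (\<rho> \<Otimes>\<^sub>M \<rho>) (G w)"
    "integral\<^sup>L (\<rho> \<Otimes>\<^sub>M \<rho>) (G w)
      = complex_of_real (surface_layer_integral \<kappa> n \<rho> \<Omega> (rank_one w))" if "w \<in> Hf" for w
  proof -
    have "double_integral_finite \<rho> \<Omega> Y (surface_density \<kappa> n (rank_one w))"
      using slf rank_one_in_jet_ops[OF Hf that] by (simp add: surface_layer_finite_def Y_def)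
    note Fubini = double_integral_finite_Fubini[OF this]
    show "integrable (\<rho> \<Otimes>\<^sub>M \<rho>) (G w)"
      using Fubini(1) unfolding set_integrable_def G_def by (rule integrable_of_real)
    show "integral\<^sup>L (\<rho> \<Otimes>\<^sub>M \<rho>) (G w)
        = complex_of_real (surface_layer_integral \<kappa> n \<rho> \<Omega> (rank_one w))"
      unfolding G_def integral_complex_of_real surface_layer_integral_def Y_def[symmetric] Fubini(2)
      by (simp add: set_lebesgue_integral_def)
  qed
  \<comment> \<open>The combination defining the commutator inner product, with each surface layer
    integral replaced by its density.\<close>
  let ?H = "\<lambda>p. 1 / 4 * (G (u + v) p - G (u - v) p)
    - \<i> / 4 * (G (u + scaleC \<i> v) p - G (u - scaleC \<i> v) p)"
  have in_Hf: "u + v \<in> Hf" "u - v \<in> Hf" "u + scaleC \<i> v \<in> Hf" "u - scaleC \<i> v \<in> Hf"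
    using uv Hf by (simp_all add: complex_vector.subspace_add complex_vector.subspace_diff
        complex_vector.subspace_scale)
  have H: "integrable (\<rho> \<Otimes>\<^sub>M \<rho>) ?H"
    "integral\<^sup>L (\<rho> \<Otimes>\<^sub>M \<rho>) ?H = commutator_inner \<kappa> n \<rho> \<Omega> u v"
    using in_Hf by (simp_all add: G commutator_inner_def Let_def)
  \<comment> \<open>The factor \<open>\<i> / 2\<close> is the inverse of \<open>- 2 * \<i>\<close>.
    Off the surface layer both sides vanish; on it, the form \<open>S\<close> is polarized.\<close>
  have pointwise: "indicator (\<Omega> \<times> Y) p *\<^sub>R (case p of (x, y) \<Rightarrow> ?B u v x y) = \<i> / 2 * ?H p" for p
  proof (cases "p \<in> \<Omega> \<times> Y")
    case True
    then obtain x y where p: "p = (x, y)" "x \<in> supp \<rho>" "y \<in> supp \<rho>"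
      using \<Omega> by (auto simp: Y_def)
    have Qxy: "Q x y \<in> spin_maps x y" "Q y x \<in> spin_maps y x"
      using Q p unfolding is_kernel_Q_def by blast+
    note density = surface_density_rank_one[OF regular Hf _ diff Q p(2,3)]
    define S where "S u v = - 2 * \<i> * ?B u v x y" for u v
    have "G w p = S w w" if "w \<in> Hf" for w
      using True density[OF that] by (simp add: G_def S_def p(1))
    then have "?H p = 1 / 4 * (S (u + v) (u + v) - S (u - v) (u - v))
        - \<i> / 4 * (S (u + scaleC \<i> v) (u + scaleC \<i> v) - S (u - scaleC \<i> v) (u - scaleC \<i> v))"
      by (simp add: in_Hf)
    also have "\<dots> = S u v"
      by (rule polarization) (simp_all add: S_def spin_form_add_left spin_form_add_right
          spin_form_scaleC_left spin_form_scaleC_right sa fr p Qxy algebra_simps)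
    finally show ?thesis
      using True by (simp add: p(1) S_def)
  qed (simp add: G_def)
  \<comment> \<open>Surface layer finiteness controls only the diagonal \<open>u = v\<close>;
    polarization extends integrability to arbitrary pairs.\<close>
  have "set_integrable (\<rho> \<Otimes>\<^sub>M \<rho>) (\<Omega> \<times> Y) (\<lambda>(x, y). ?B u v x y)"
    unfolding set_integrable_def pointwise using H(1) by (rule integrable_mult_right)
  moreover have int_B: "(LINT (x, y):\<Omega> \<times> Y|\<rho> \<Otimes>\<^sub>M \<rho>. ?B u v x y)
      = \<i> / 2 * commutator_inner \<kappa> n \<rho> \<Omega> u v"
    unfolding set_lebesgue_integral_def pointwise H(2)[symmetric] by (rule integral_mult_right_zero)
  moreover have "commutator_inner \<kappa> n \<rho> \<Omega> u v
      = - 2 * \<i> * (LINT (x, y):\<Omega> \<times> Y|\<rho> \<Otimes>\<^sub>M \<rho>. ?B u v x y)"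
    unfolding int_B by simp
  ultimately show ?thesis
    unfolding spin_form_def Y_def by blast
qed

end
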